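(* Let $\pi:X\to Y$ be a factor code on an SFT $X$ and $\nu$ an ergodic measure on $Y$ with class degree $c=c_{\pi,\nu}$. Let $\lambda,\lambda'$ be class degree joinings over $\nu$. Then there is a permutation $f:\{1,\dots,c\}\to\{1,\dots,c\}$ such that $p_f\lambda$ is class parallel to $\lambda'$, where $p_f:X^c\to X^c$ is the map $p_f(x_1,\dots,x_c)=(x_{f(1)},\dots,x_{f(c)})$.
   Context: An SFT is a two-sided shift of finite type with finite alphabet; a factor code $\pi:X\to Y$ is a shift-commuting continuous surjection onto a shift space $Y$. "Measure" means Borel probability measure, "ergodic measure" an ergodic shift-invariant measure; maps applied to measures mean pushforward. Transition classes: for $y\in Y$ and $x,x'\in\pi^{-1}(y)$, say there is a transition from $x$ to $x'$ if for every integer $n$ there is $z\in X$ with $\pi(z)=y$, $z_i=x_i$ for all $i\le n$, and $z_i=x'_i$ for all sufficiently large $i$ (for a 1-block code on a 1-step SFT: infinitely many times to the right one can pass from $x$ to $x'$ via finite $X$-words while keeping the same image $y$). Write $x\sim x'$ if there is a transition from $x$ to $x'$ and one from $x'$ to $x$. This is an equivalence relation on $\pi^{-1}(y)$ with finitely many classes, called transition classes over $y$; $[x]$ denotes the class of $x$. For an ergodic measure $\nu$ on $Y$, $\nu$-a.e. $y$ has the same finite number of transition classes over it; this number is the class degree $c_{\pi,\nu}$ of $\nu$. An $n$-fold ($\pi$-)relative joining is a measure $\lambda$ on $X^n$, invariant under the product shift action, such that $\pi(x^{(1)})=\dots=\pi(x^{(n)})$ for $\lambda$-a.e. $(x^{(1)},\dots,x^{(n)})$.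 With $p_i:X^n\to X$ the $i$-th projection, it is over $\nu$ if $\pi p_i\lambda=\nu$ for some (hence every) $i$. It is class separating if for $\lambda$-a.e. $(x^{(1)},\dots,x^{(n)})$ the points $x^{(1)},\dots,x^{(n)}$ lie in $n$ different transition classes over their common image. A class degree joining over $\nu$ (with respect to $\pi$) is an ergodic $c_{\pi,\nu}$-fold class separating relative joining over $\nu$. Two $n$-fold relative joinings $\lambda,\lambda'$ over $\nu$ are class parallel if there is a $2n$-fold relative joining $\lambda''$ over $\nu$ whose projection to the first $n$ coordinates is $\lambda$, whose projection to the last $n$ coordinates is $\lambda'$, and such that for $\lambda''$-a.e. $(x_1,\dots,x_n,x'_1,\dots,x'_n)$ one has $x_i\sim x'_i$ for each $1\le i\le n$. *)

theory Defs
  imports "HOL-Probability.Probability" "HOL-Combinatorics.Permutations"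
begin

text \<open>A finite alphabet is a finite type with the discrete topology. The full shift
  is then the type \<open>int \<Rightarrow> 'a\<close> with its (product) topology.\<close>

class alphabet = finite + discrete_topology

instance bool :: alphabet ..

instance alphabet \<subseteq> second_countable_topology
proof
  have "open = generate_topology (UNIV :: 'a set set)"
    by (intro ext iffI) (rule generate_topology.Basis, rule UNIV_I, rule discrete_topology_class.open_discrete)
  then show "\<exists>B::'a set set. countable B \<and> open = generate_topology B"
    by (intro exI[of _ UNIV]) (simp add: countable_finite)
qed

definition shift :: "(int \<Rightarrow> 'a) \<Rightarrow> int \<Rightarrow> 'a" where
  "shift x = (\<lambda>i. x (i + 1))"

definition shift_space :: "(int \<Rightarrow> 'a::alphabet) set \<Rightarrow> bool" where
  "shift_space Y \<longleftrightarrow> closed Y \<and> shift ` Y = Y"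

definition occurs_in :: "'a list \<Rightarrow> (int \<Rightarrow> 'a) \<Rightarrow> bool" where
  "occurs_in w x \<longleftrightarrow> (\<exists>i::int. \<forall>k<length w. x (i + int k) = w ! k)"

definition sft :: "(int \<Rightarrow> 'a::alphabet) set \<Rightarrow> bool" where
  "sft X \<longleftrightarrow> (\<exists>F. finite F \<and> X = {x. \<forall>w\<in>F. \<not> occurs_in w x})"

text \<open>The values of \<open>\<pi>\<close> outside \<open>X\<close> are irrelevant here and below.\<close>

definition factor_code ::
  "(int \<Rightarrow> 'a::alphabet) set \<Rightarrow> (int \<Rightarrow> 'b::alphabet) set \<Rightarrow> ((int \<Rightarrow> 'a) \<Rightarrow> (int \<Rightarrow> 'b)) \<Rightarrow> bool" where
  "factor_code X Y \<pi> \<longleftrightarrow>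
     continuous_on X \<pi> \<and> \<pi> ` X = Y \<and> (\<forall>x\<in>X. \<pi> (shift x) = shift (\<pi> x))"

definition transition ::
  "(int \<Rightarrow> 'a) set \<Rightarrow> ((int \<Rightarrow> 'a) \<Rightarrow> (int \<Rightarrow> 'b)) \<Rightarrow> (int \<Rightarrow> 'a) \<Rightarrow> (int \<Rightarrow> 'a) \<Rightarrow> bool" where
  "transition X \<pi> x x' \<longleftrightarrow>
     x \<in> X \<and> x' \<in> X \<and> \<pi> x' = \<pi> x \<and>
     (\<forall>n. \<exists>z\<in>X. \<pi> z = \<pi> x \<and> (\<forall>i\<le>n. z i = x i) \<and> (\<exists>m. \<forall>i\<ge>m. z i = x' i))"

definition trans_rel ::
  "(int \<Rightarrow> 'a) set \<Rightarrow> ((int \<Rightarrow> 'a) \<Rightarrow> (int \<Rightarrow> 'b)) \<Rightarrow> ((int \<Rightarrow> 'a) \<times> (int \<Rightarrow> 'a)) set" where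
  "trans_rel X \<pi> = {(x, x'). transition X \<pi> x x' \<and> transition X \<pi> x' x}"

definition transition_classes ::
  "(int \<Rightarrow> 'a) set \<Rightarrow> ((int \<Rightarrow> 'a) \<Rightarrow> (int \<Rightarrow> 'b)) \<Rightarrow> (int \<Rightarrow> 'b) \<Rightarrow> (int \<Rightarrow> 'a) set set" where
  "transition_classes X \<pi> y = {x \<in> X. \<pi> x = y} // trans_rel X \<pi>"

definition invariant_measure :: "'s measure \<Rightarrow> ('s \<Rightarrow> 's) \<Rightarrow> bool" where
  "invariant_measure M T \<longleftrightarrow> prob_space M \<and> T \<in> measurable M M \<and> distr M M T = M"

definition ergodic_measure :: "'s measure \<Rightarrow> ('s \<Rightarrow> 's) \<Rightarrow> bool" where
  "ergodic_measure M T \<longleftrightarrow> invariant_measure M T \<and>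
     (\<forall>A\<in>sets M. T -` A \<inter> space M = A \<longrightarrow> emeasure M A = 0 \<or> emeasure M A = 1)"

definition borel_on :: "'s::topological_space set \<Rightarrow> 's measure" where
  "borel_on X = restrict_space borel X"

definition ergodic_measure_on :: "(int \<Rightarrow> 'a::alphabet) set \<Rightarrow> (int \<Rightarrow> 'a) measure \<Rightarrow> bool" where
  "ergodic_measure_on Y \<nu> \<longleftrightarrow> sets \<nu> = sets (borel_on Y) \<and> ergodic_measure \<nu> shift"

definition class_degree ::
  "(int \<Rightarrow> 'a) set \<Rightarrow> ((int \<Rightarrow> 'a) \<Rightarrow> (int \<Rightarrow> 'b)) \<Rightarrow> (int \<Rightarrow> 'b) measure \<Rightarrow> nat" where
  "class_degree X \<pi> \<nu> =
     (THE c. AE y in \<nu>. finite (transition_classes X \<pi> y) \<and> card (transition_classes X \<pi> y) = c)"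

text \<open>Points of \<open>X\<^sup>n\<close> are represented as extensional functions on \<open>{1..n}\<close>; as the topology is
  second countable, the product \<open>\<sigma>\<close>-algebra is the Borel \<open>\<sigma>\<close>-algebra of \<open>X\<^sup>n\<close>.\<close>

definition borel_pow :: "(int \<Rightarrow> 'a::alphabet) set \<Rightarrow> nat \<Rightarrow> (nat \<Rightarrow> int \<Rightarrow> 'a) measure" where
  "borel_pow X n = PiM {1..n} (\<lambda>_. borel_on X)"

definition shift_pow :: "nat \<Rightarrow> (nat \<Rightarrow> int \<Rightarrow> 'a) \<Rightarrow> nat \<Rightarrow> int \<Rightarrow> 'a" where
  "shift_pow n x = (\<lambda>i\<in>{1..n}. shift (x i))"

definition relative_joining ::
  "(int \<Rightarrow> 'a::alphabet) set \<Rightarrow> ((int \<Rightarrow> 'a) \<Rightarrow> (int \<Rightarrow> 'b::alphabet)) \<Rightarrow> nat \<Rightarrow>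
   (nat \<Rightarrow> int \<Rightarrow> 'a) measure \<Rightarrow> bool" where
  "relative_joining X \<pi> n L \<longleftrightarrow>
     sets L = sets (borel_pow X n) \<and> invariant_measure L (shift_pow n) \<and>
     (AE x in L. \<forall>i\<in>{1..n}. \<forall>j\<in>{1..n}. \<pi> (x i) = \<pi> (x j))"

definition relative_joining_over ::
  "(int \<Rightarrow> 'a::alphabet) set \<Rightarrow> (int \<Rightarrow> 'b::alphabet) set \<Rightarrow> ((int \<Rightarrow> 'a) \<Rightarrow> (int \<Rightarrow> 'b)) \<Rightarrow>
   (int \<Rightarrow> 'b) measure \<Rightarrow> nat \<Rightarrow> (nat \<Rightarrow> int \<Rightarrow> 'a) measure \<Rightarrow> bool" where
  "relative_joining_over X Y \<pi> \<nu> n L \<longleftrightarrow>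
     relative_joining X \<pi> n L \<and>
     (\<exists>i\<in>{1..n}. distr (distr L (borel_on X) (\<lambda>x. x i)) (borel_on Y) \<pi> = \<nu>)"

definition class_separating ::
  "(int \<Rightarrow> 'a) set \<Rightarrow> ((int \<Rightarrow> 'a) \<Rightarrow> (int \<Rightarrow> 'b)) \<Rightarrow> nat \<Rightarrow> (nat \<Rightarrow> int \<Rightarrow> 'a) measure \<Rightarrow> bool" where
  "class_separating X \<pi> n L \<longleftrightarrow> (AE x in L. inj_on (\<lambda>i. trans_rel X \<pi> `` {x i}) {1..n})"

definition class_degree_joining ::
  "(int \<Rightarrow> 'a::alphabet) set \<Rightarrow> (int \<Rightarrow> 'b::alphabet) set \<Rightarrow> ((int \<Rightarrow> 'a) \<Rightarrow> (int \<Rightarrow> 'b)) \<Rightarrow>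
   (int \<Rightarrow> 'b) measure \<Rightarrow> (nat \<Rightarrow> int \<Rightarrow> 'a) measure \<Rightarrow> bool" where
  "class_degree_joining X Y \<pi> \<nu> L \<longleftrightarrow>
     relative_joining_over X Y \<pi> \<nu> (class_degree X \<pi> \<nu>) L \<and>
     class_separating X \<pi> (class_degree X \<pi> \<nu>) L \<and>
     ergodic_measure L (shift_pow (class_degree X \<pi> \<nu>))"

definition class_parallel ::
  "(int \<Rightarrow> 'a::alphabet) set \<Rightarrow> (int \<Rightarrow> 'b::alphabet) set \<Rightarrow> ((int \<Rightarrow> 'a) \<Rightarrow> (int \<Rightarrow> 'b)) \<Rightarrow>
   (int \<Rightarrow> 'b) measure \<Rightarrow> nat \<Rightarrow> (nat \<Rightarrow> int \<Rightarrow> 'a) measure \<Rightarrow> (nat \<Rightarrow> int \<Rightarrow> 'a) measure \<Rightarrow> bool" where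
  "class_parallel X Y \<pi> \<nu> n L L' \<longleftrightarrow>
     relative_joining_over X Y \<pi> \<nu> n L \<and> relative_joining_over X Y \<pi> \<nu> n L' \<and>
     (\<exists>L''. relative_joining_over X Y \<pi> \<nu> (2 * n) L'' \<and>
        distr L'' (borel_pow X n) (\<lambda>x. \<lambda>i\<in>{1..n}. x i) = L \<and>
        distr L'' (borel_pow X n) (\<lambda>x. \<lambda>i\<in>{1..n}. x (n + i)) = L' \<and>
        (AE x in L''. \<forall>i\<in>{1..n}. (x i, x (n + i)) \<in> trans_rel X \<pi>))"

definition permute_coords :: "nat \<Rightarrow> (nat \<Rightarrow> nat) \<Rightarrow> (nat \<Rightarrow> int \<Rightarrow> 'a) \<Rightarrow> nat \<Rightarrow> int \<Rightarrow> 'a" where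
  "permute_coords n f x = (\<lambda>i\<in>{1..n}. x (f i))"

end

theory Submission
  imports Defs
begin

text \<open>
  The idea is to couple the two joinings over \<open>\<nu>\<close> and to read off the permutation from a
  typical point of the coupling. A point of a coupling of \<open>L\<close> and \<open>L'\<close> consists of points
  \<open>x\<^sub>1, \<dots>, x\<^sub>c, x'\<^sub>1, \<dots>, x'\<^sub>c\<close> over one \<open>y\<close>. Over almost every \<open>y\<close> there are exactly \<open>c\<close> classes,
  the \<open>x\<^sub>i\<close> meet each of them once, and so do the \<open>x'\<^sub>i\<close>; hence some permutation \<open>f\<close> satisfies
  \<open>x\<^bsub>f i\<^esub> \<sim> x'\<^sub>i\<close> for all \<open>i\<close> (\<open>matching_permutation\<close>). There are finitely many permutations, so
  for one \<open>f\<close> this happens on a set \<open>A\<close> of positive measure, and \<open>A\<close> is invariant because the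
  equivalence \<open>\<sim>\<close> commutes with the shift. Conditioning the coupling on \<open>A\<close> keeps it invariant;
  its marginals become absolutely continuous with respect to \<open>L\<close> and \<open>L'\<close>, and an invariant
  probability measure that is absolutely continuous with respect to an ergodic one equals it
  (\<open>ergodic_measure_extremal\<close>). So the conditioned measure still couples \<open>L\<close> and \<open>L'\<close>; this
  takes the place of the choice of an ergodic component. Permuting its first \<open>c\<close> coordinates by
  \<open>f\<close> gives the required parallel joining.

  Three facts carry this argument.

  The first is that almost every fibre has \<open>class_degree X \<pi> \<nu>\<close> many classes, that is, that the
  number of classes is finite and almost surely constant (\<open>AE_card_transition_classes\<close>). The
  number is not visibly a measurable function of \<open>y\<close>, so it is compared with a measurable local
  quantity. Call \<open>y\<close> routable through \<open>d\<close> windows at time \<open>n\<close> if there are \<open>d\<close> patterns such that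
  every preimage of \<open>y\<close> can be rerouted near \<open>n\<close>, over the same \<open>y\<close>, so as to show one of them at
  \<open>n\<close>. Preimages showing the same pattern can be interchanged from there on, so infinitely many
  routing times leave at most \<open>d\<close> classes; conversely, if there are \<open>d\<close> classes, then a
  compactness argument yields a routing time with \<open>d\<close> patterns. The least \<open>d\<close> that works with
  positive probability occurs infinitely often by recurrence and is therefore the number of
  classes.

  The second is that some coupling over \<open>\<nu>\<close> exists (\<open>relative_joining_exists\<close>). For a finite
  window of coordinates, the two measures are coupled independently given the image in the
  window; averaging over shifts makes this almost invariant. A cluster point of the values on
  clopen sets, as the windows grow, is finitely additive, and on a compact space it extends to a
  measure. All required properties are expressed by clopen sets and so pass to the limit. This
  avoids conditional measures.

  The third is that \<open>\<sim>\<close> is a Borel relation (\<open>trans_rel_borel\<close>): with the two switching times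
  bounded it is a projection of a compact set.
\<close>

section \<open>Topology of sequence spaces\<close>

lemma compact_UNIV_fun:
  assumes "compact (UNIV :: 'a::topological_space set)"
  shows "compact (UNIV :: ('i \<Rightarrow> 'a) set)"
proof -
  have "compact_space (product_topology (\<lambda>_::'i. euclidean :: 'a topology) UNIV)"
    using assms by (subst compact_space_product_topology) (simp add: compact_space_def)
  then show ?thesis
    by (simp add: euclidean_product_topology compact_space_def)
qed

text \<open>Compact sets of sequences, and of tuples of sequences, have to be closed. Being Hausdorff passes to
  products over an arbitrary index type; stated for the abstract topology, this can be iterated.\<close>

lemma Hausdorff_euclidean_t2: "Hausdorff_space (euclidean :: 'a::t2_space topology)"
  unfolding Hausdorff_space_def using hausdorff by (auto simp: disjnt_def)

lemma Hausdorff_euclidean_fun: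
  assumes "Hausdorff_space (euclidean :: 'a::topological_space topology)"
  shows "Hausdorff_space (euclidean :: ('i \<Rightarrow> 'a) topology)"
  unfolding euclidean_product_topology[symmetric] Hausdorff_space_product_topology using assms by blast

lemma compact_imp_closed_Hausdorff:
  fixes K :: "'a::topological_space set"
  assumes "Hausdorff_space (euclidean :: 'a topology)" and "compact K"
  shows "closed K"
  using compactin_imp_closedin[OF assms(1), of K] assms(2) by simp

lemmas compact_imp_closed_fun =
  compact_imp_closed_Hausdorff[OF Hausdorff_euclidean_fun[OF Hausdorff_euclidean_t2]]

lemma compact_UNIV_seq: "compact (UNIV :: (int \<Rightarrow> 'a::alphabet) set)"
  by (rule compact_UNIV_fun) (simp add: finite_imp_compact)

lemma open_coord_eq: "open {x :: 'i \<Rightarrow> 'a::discrete_topology. x i = a}"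
  using open_vimage[OF discrete_topology_class.open_discrete[of "{a}"] continuous_on_product_coordinates[of i]]
  by (simp add: vimage_def)

lemma closed_agree: "closed {p :: ('i \<Rightarrow> 'a::t2_space) \<times> ('i \<Rightarrow> 'a). \<forall>i\<in>I. fst p i = snd p i}"
proof -
  have "closed (\<Inter>i\<in>I. {p :: ('i \<Rightarrow> 'a) \<times> ('i \<Rightarrow> 'a). fst p i = snd p i})"
    by (intro closed_INT ballI closed_Collect_eq
        continuous_on_product_then_coordinatewise[OF continuous_on_fst[OF continuous_on_id]]
        continuous_on_product_then_coordinatewise[OF continuous_on_snd[OF continuous_on_id]])
  then show ?thesis
    by (simp add: INTER_eq)
qed

lemma compact_decseq_empty:
  fixes K :: "nat \<Rightarrow> 'a::topological_space set"
  assumes "compact S" and "\<And>n. closed (K n)" and "\<And>n. K n \<subseteq> S" and "decseq K" and "(\<Inter>n. K n) = {}"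
  shows "\<exists>n. K n = {}"
proof -
  have "S \<inter> \<Inter>(range K) = {}" using assms(5) by auto
  then obtain B where B: "B \<subseteq> range K" "finite B" "S \<inter> \<Inter>B = {}"
    using assms(1)[unfolded compact_fip] assms(2) by (metis (no_types, lifting) imageE)
  obtain N where N: "finite N" "B = K ` N" using finite_subset_image[OF B(2,1)] by metis
  have "K (Max (insert 0 N)) \<subseteq> K n" if "n \<in> N" for n
    by (rule decseqD[OF assms(4)]) (use N(1) that in auto)
  then have "K (Max (insert 0 N)) \<subseteq> S \<inter> \<Inter>B"
    using assms(3) N(2) by blast
  then show ?thesis using B(3) by blast
qed

section \<open>Locality of shifts of finite type and of codes\<close>

text \<open>A forbidden word that starts at \<open>j\<close> lies in the window of radius \<open>R\<close> around \<open>j\<close> as soon as \<open>R\<close>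
  bounds the length of every forbidden word; the sum of the lengths is such a bound.\<close>

lemma sft_local:
  assumes "sft X"
  obtains R where "0 \<le> R" "\<And>z. (\<And>j. \<exists>u\<in>X. \<forall>i. \<bar>i - j\<bar> \<le> R \<longrightarrow> z i = u i) \<Longrightarrow> z \<in> X"
proof -
  obtain F where F: "finite F" "X = {x. \<forall>w\<in>F. \<not> occurs_in w x}" using assms unfolding sft_def by blast
  define R where "R = int (\<Sum>w\<in>F. length w)"
  have "z \<in> X" if z: "\<And>j. \<exists>u\<in>X. \<forall>i. \<bar>i - j\<bar> \<le> R \<longrightarrow> z i = u i" for z
  proof (rule ccontr)
    assume "z \<notin> X"
    then obtain w where w: "w \<in> F" "occurs_in w z" using F by blast
    then obtain j where j: "\<forall>k<length w. z (j + int k) = w ! k" unfolding occurs_in_def by blast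
    obtain u where u: "u \<in> X" "\<forall>i. \<bar>i - j\<bar> \<le> R \<longrightarrow> z i = u i" using z by blast
    have "length w \<le> (\<Sum>w\<in>F. length w)" using F(1) w(1) by (intro member_le_sum) auto
    then have "\<bar>j + int k - j\<bar> \<le> R" if "k < length w" for k
      using that unfolding R_def by (simp del: of_nat_sum)
    then have "\<forall>k<length w. u (j + int k) = w ! k"
      using j u(2) by metis
    then have "occurs_in w u" unfolding occurs_in_def by blast
    then show False using u(1) w(1) F(2) by blast
  qed
  moreover have "0 \<le> R" unfolding R_def by (simp add: sum_nonneg)
  ultimately show thesis using that by blast
qed

lemma occurs_in_shift: "occurs_in w (shift x) \<longleftrightarrow> occurs_in w x"
proof
  assume "occurs_in w (shift x)"
  then obtain i where "\<forall>k<length w. shift x (i + int k) = w ! k" unfolding occurs_in_def by blast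
  then have "\<forall>k<length w. x ((i + 1) + int k) = w ! k"
    by (simp add: shift_def algebra_simps)
  then show "occurs_in w x" unfolding occurs_in_def by blast
next
  assume "occurs_in w x"
  then obtain i where "\<forall>k<length w. x (i + int k) = w ! k" unfolding occurs_in_def by blast
  then have "\<forall>k<length w. shift x ((i - 1) + int k) = w ! k"
    by (simp add: shift_def algebra_simps)
  then show "occurs_in w (shift x)" unfolding occurs_in_def by blast
qed

lemma shift_surj: "\<exists>x'. shift x' = x"
  by (rule exI[of _ "\<lambda>i. x (i - 1)"]) (simp add: shift_def)

lemma shift_inj: "shift a = shift b \<Longrightarrow> a = b"
proof
  fix i assume "shift a = shift b"
  then show "a i = b i" using fun_cong[of "shift a" "shift b" "i - 1"] unfolding shift_def by simp
qed

lemma sft_shift_iff: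
  assumes "sft X" shows "shift x \<in> X \<longleftrightarrow> x \<in> X"
  using assms unfolding sft_def by (auto simp: occurs_in_shift)

lemma sft_closed:
  fixes X :: "(int \<Rightarrow> 'a::alphabet) set"
  assumes "sft X" shows "closed X"
proof -
  obtain F where F: "finite F" "X = {x. \<forall>w\<in>F. \<not> occurs_in w x}" using assms unfolding sft_def by blast
  have "- X = (\<Union>w\<in>F. \<Union>j. \<Inter>k\<in>{..<length w}. {x. x (j + int k) = w ! k})"
    unfolding F(2) occurs_in_def by auto
  also have "open \<dots>" by (intro open_UN ballI open_INT finite_lessThan open_coord_eq)
  finally show ?thesis by (simp add: closed_def)
qed

text \<open>The Curtis--Hedlund--Lyndon argument. The pairs of points that agree on \<open>[-n, n]\<close> but whose images
  differ at \<open>0\<close> form a decreasing sequence of compact sets. Its intersection is empty, so one of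
  the sets is empty.\<close>

lemma continuous_code_window:
  fixes X :: "(int \<Rightarrow> 'a::alphabet) set" and \<pi> :: "(int \<Rightarrow> 'a) \<Rightarrow> int \<Rightarrow> 'b::alphabet"
  assumes "closed X" and "continuous_on X \<pi>"
  obtains R :: int where "\<And>u z. u \<in> X \<Longrightarrow> z \<in> X \<Longrightarrow> (\<And>i. \<bar>i\<bar> \<le> R \<Longrightarrow> u i = z i) \<Longrightarrow> \<pi> u 0 = \<pi> z 0"
proof -
  define D where "D = (\<Union>(a, b)\<in>{p :: 'b \<times> 'b. fst p \<noteq> snd p}. {x\<in>X. \<pi> x 0 = a} \<times> {x\<in>X. \<pi> x 0 = b})"
  have cl: "closed {x\<in>X. \<pi> x 0 = a}" for a
    using continuous_closed_preimage[OF continuous_on_product_then_coordinatewise[OF assms(2)] assms(1), of "{a}" 0]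
    by (simp add: vimage_def Int_def)
  have "closed D" unfolding D_def
    by (intro closed_UN) (auto intro!: closed_Times cl)
  define K where "K n = D \<inter> {p. \<forall>i\<in>{- int n..int n}. fst p i = snd p i}" for n
  have D: "(u, z) \<in> D \<longleftrightarrow> u \<in> X \<and> z \<in> X \<and> \<pi> u 0 \<noteq> \<pi> z 0" for u z
    by (auto simp: D_def)
  have "\<exists>n. K n = {}"
  proof (rule compact_decseq_empty[of UNIV])
    show "compact (UNIV :: ((int \<Rightarrow> 'a) \<times> (int \<Rightarrow> 'a)) set)"
      using compact_Times[OF compact_UNIV_seq compact_UNIV_seq] by simp
    show "closed (K n)" for n unfolding K_def by (intro closed_Int \<open>closed D\<close> closed_agree)
    show "decseq K" by (auto simp: decseq_def K_def)
    show "\<Inter> (range K) = {}"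
    proof (rule ccontr)
      assume "\<Inter> (range K) \<noteq> {}"
      then obtain u z where p: "\<And>n. (u, z) \<in> K n" by auto
      have "\<forall>i\<in>{- int n..int n}. u i = z i" for n using p[of n] by (simp add: K_def)
      moreover have "i \<in> {- int (nat \<bar>i\<bar>)..int (nat \<bar>i\<bar>)}" for i by auto
      ultimately have "u i = z i" for i by blast
      then have "u = z" by auto
      then show False using p[of 0] by (simp add: K_def D)
    qed
  qed auto
  then obtain n where n: "K n = {}" by blast
  show thesis
  proof (rule that[of "int n"])
    fix u z assume "u \<in> X" "z \<in> X" "\<And>i. \<bar>i\<bar> \<le> int n \<Longrightarrow> u i = z i"
    then have "\<pi> u 0 \<noteq> \<pi> z 0 \<longrightarrow> (u, z) \<in> K n" by (auto simp: K_def D abs_le_iff)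
    then show "\<pi> u 0 = \<pi> z 0" using n by auto
  qed
qed

text \<open>Everything about \<open>X\<close> and \<open>\<pi>\<close> that the combinatorial part needs: one radius \<open>R\<close> that works both
  for membership in \<open>X\<close> and for the values of \<open>\<pi>\<close>. It spares the recoding to a 1-block code on a
  1-step shift; the pattern in a window of radius \<open>R\<close> plays the role of a symbol.\<close>

locale local_code =
  fixes X :: "(int \<Rightarrow> 'a::alphabet) set" and \<pi> :: "(int \<Rightarrow> 'a) \<Rightarrow> int \<Rightarrow> 'b::alphabet" and R :: int
  assumes closed_X: "closed X"
    and continuous_code: "continuous_on X \<pi>"
    and shift_in_iff: "shift x \<in> X \<longleftrightarrow> x \<in> X"
    and code_shift: "x \<in> X \<Longrightarrow> \<pi> (shift x) = shift (\<pi> x)"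
    and R_nonneg: "0 \<le> R"
    and X_local: "(\<And>j. \<exists>u\<in>X. \<forall>i. \<bar>i - j\<bar> \<le> R \<longrightarrow> z i = u i) \<Longrightarrow> z \<in> X"
    and code_local_at_0: "u \<in> X \<Longrightarrow> z \<in> X \<Longrightarrow> (\<And>i. \<bar>i\<bar> \<le> R \<Longrightarrow> u i = z i) \<Longrightarrow> \<pi> u 0 = \<pi> z 0"

lemma factor_code_local_code:
  fixes X :: "(int \<Rightarrow> 'a::alphabet) set" and Y :: "(int \<Rightarrow> 'b::alphabet) set"
  assumes "sft X" "factor_code X Y \<pi>"
  obtains R where "local_code X \<pi> R"
proof -
  have f: "continuous_on X \<pi>" "\<And>x. x \<in> X \<Longrightarrow> \<pi> (shift x) = shift (\<pi> x)"
    using assms(2) by (auto simp: factor_code_def)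
  obtain R1 where R1: "0 \<le> R1" "\<And>z. (\<And>j. \<exists>u\<in>X. \<forall>i. \<bar>i - j\<bar> \<le> R1 \<longrightarrow> z i = u i) \<Longrightarrow> z \<in> X"
    using sft_local[OF assms(1)] by blast
  obtain R2 :: int where R2: "\<And>u z. u \<in> X \<Longrightarrow> z \<in> X \<Longrightarrow> (\<And>i. \<bar>i\<bar> \<le> R2 \<Longrightarrow> u i = z i) \<Longrightarrow> \<pi> u 0 = \<pi> z 0"
    using continuous_code_window[OF sft_closed[OF assms(1)] f(1)] by blast
  have "local_code X \<pi> (max R1 R2)"
  proof
    show "z \<in> X" if z: "\<And>j. \<exists>u\<in>X. \<forall>i. \<bar>i - j\<bar> \<le> max R1 R2 \<longrightarrow> z i = u i" for z
    proof (rule R1(2))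
      fix j show "\<exists>u\<in>X. \<forall>i. \<bar>i - j\<bar> \<le> R1 \<longrightarrow> z i = u i"
        using z[of j] by (metis max.coboundedI1)
    qed
    show "\<pi> u 0 = \<pi> z 0" if "u \<in> X" "z \<in> X" "\<And>i. \<bar>i\<bar> \<le> max R1 R2 \<Longrightarrow> u i = z i" for u z
      using R2[OF that(1,2)] that(3) by (metis max.coboundedI2)
  qed (use sft_closed[OF assms(1)] sft_shift_iff[OF assms(1)] f R1(1) in auto)
  then show thesis by (rule that)
qed

section \<open>Splicing and the transition relation\<close>

context local_code
begin

lemma compact_X: "compact X"
  using compact_Int_closed[OF compact_UNIV_seq closed_X] by simp

lemma code_local_at:
  assumes "u \<in> X" "z \<in> X" "\<And>i. \<bar>i - j\<bar> \<le> R \<Longrightarrow> u i = z i"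
  shows "\<pi> u j = \<pi> z j"
  using assms
proof (induction "nat \<bar>j\<bar>" arbitrary: j u z)
  case 0
  then show ?case using code_local_at_0[of u z] by simp
next
  case (Suc k)
  show ?case
  proof (cases "j > 0")
    case True
    have "\<pi> (shift u) (j - 1) = \<pi> (shift z) (j - 1)"
    proof (rule Suc(1))
      show "k = nat \<bar>j - 1\<bar>" using Suc(2) True by simp
      show "shift u i = shift z i" if "\<bar>i - (j - 1)\<bar> \<le> R" for i
        unfolding shift_def by (rule Suc(5)) (use that in simp)
    qed (use Suc(3,4) shift_in_iff in auto)
    then show ?thesis using Suc(3,4) by (simp add: code_shift) (simp add: shift_def)
  next
    case False
    then have "j < 0" using Suc(2) by simp
    obtain u' z' where uz: "shift u' = u" "shift z' = z" using shift_surj by metis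
    then have in_X: "u' \<in> X" "z' \<in> X" using Suc(3,4) shift_in_iff by auto
    have "\<pi> u' (j + 1) = \<pi> z' (j + 1)"
    proof (rule Suc(1))
      show "k = nat \<bar>j + 1\<bar>" using Suc(2) \<open>j < 0\<close> by simp
      show "u' i = z' i" if "\<bar>i - (j + 1)\<bar> \<le> R" for i
        using Suc(5)[of "i - 1"] that unfolding uz[symmetric] shift_def by (simp add: algebra_simps)
    qed fact+
    then show ?thesis using in_X by (simp add: uz[symmetric] code_shift) (simp add: shift_def)
  qed
qed

text \<open>Membership in \<open>X\<close> and the image are both decided window by window, so a sequence assembled from
  pieces of points of \<open>X\<close> needs to be inspected only one window at a time. Every rerouting below
  is an instance of this.\<close>

lemma splice:
  assumes "\<And>j. \<exists>u\<in>X. (\<forall>i. \<bar>i - j\<bar> \<le> R \<longrightarrow> z i = u i) \<and> \<pi> u j = t j"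
  shows "z \<in> X" "\<pi> z = t"
proof -
  show z: "z \<in> X" by (rule X_local) (use assms in blast)
  show "\<pi> z = t"
  proof
    fix j
    obtain u where "u \<in> X" "\<forall>i. \<bar>i - j\<bar> \<le> R \<longrightarrow> z i = u i" "\<pi> u j = t j" using assms by blast
    then show "\<pi> z j = t j" using code_local_at[of z u j] z by simp
  qed
qed

lemma glue:
  assumes "x \<in> X" "x' \<in> X" "\<pi> x' = \<pi> x" "\<And>i. \<bar>i - n\<bar> \<le> R \<Longrightarrow> x i = x' i"
  shows "(\<lambda>i. if i \<le> n then x i else x' i) \<in> X" (is "?z \<in> X")
    and "\<pi> (\<lambda>i. if i \<le> n then x i else x' i) = \<pi> x"
proof -
  have "\<exists>u\<in>X. (\<forall>i. \<bar>i - j\<bar> \<le> R \<longrightarrow> ?z i = u i) \<and> \<pi> u j = \<pi> x j" for j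
  proof (cases "j \<le> n")
    case True
    have "?z i = x i" if "\<bar>i - j\<bar> \<le> R" for i
      using assms(4)[of i] True that by auto
    then show ?thesis using assms(1) by blast
  next
    case False
    have "?z i = x' i" if "\<bar>i - j\<bar> \<le> R" for i
      using assms(4)[of i] False that by auto
    then show ?thesis using assms(2,3) by auto
  qed
  from splice[OF this] show "?z \<in> X" "\<pi> ?z = \<pi> x" .
qed

lemma transition_refl: "x \<in> X \<Longrightarrow> transition X \<pi> x x"
  unfolding transition_def by auto

text \<open>A path from \<open>x\<close> that has merged with \<open>x'\<close> is left for a path from \<open>x'\<close> to \<open>x''\<close> that follows
  \<open>x'\<close> long enough for the two paths to share a full window.\<close>

lemma transition_trans:
  assumes "transition X \<pi> x x'" "transition X \<pi> x' x''"
  shows "transition X \<pi> x x''"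
  unfolding transition_def
proof (intro conjI allI)
  fix n
  obtain z m where z: "z \<in> X" "\<pi> z = \<pi> x" "\<forall>i\<le>n. z i = x i" "\<forall>i\<ge>m. z i = x' i"
    using assms(1) unfolding transition_def by blast
  define k where "k = max n m + R"
  obtain z' m' where z': "z' \<in> X" "\<pi> z' = \<pi> x'" "\<forall>i\<le>k + R. z' i = x' i" "\<forall>i\<ge>m'. z' i = x'' i"
    using assms(2) unfolding transition_def by blast
  have eq: "\<pi> z' = \<pi> z" using z z' assms(1) by (simp add: transition_def)
  have agree: "z i = z' i" if "\<bar>i - k\<bar> \<le> R" for i
    using z(4) z'(3) that by (simp add: k_def abs_le_iff)
  let ?w = "\<lambda>i. if i \<le> k then z i else z' i"
  have w: "?w \<in> X" "\<pi> ?w = \<pi> x"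
    using glue[OF z(1) z'(1) eq agree] z(2) by auto
  moreover have "\<forall>i\<le>n. ?w i = x i" using z(3) R_nonneg by (auto simp: k_def)
  moreover have "\<forall>i\<ge>max m' (k + 1). ?w i = x'' i" using z'(4) by auto
  ultimately show "\<exists>z\<in>X. \<pi> z = \<pi> x \<and> (\<forall>i\<le>n. z i = x i) \<and> (\<exists>m. \<forall>i\<ge>m. z i = x'' i)" by blast
qed (use assms in \<open>auto simp: transition_def\<close>)

lemma equiv_trans_rel: "equiv X (trans_rel X \<pi>)"
proof (rule equivI)
  show "trans_rel X \<pi> \<subseteq> X \<times> X" by (auto simp: trans_rel_def transition_def)
  show "refl_on X (trans_rel X \<pi>)"
    by (rule refl_onI) (use transition_refl in \<open>auto simp: trans_rel_def transition_def\<close>)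
  show "sym (trans_rel X \<pi>)" by (auto simp: sym_def trans_rel_def)
  show "trans (trans_rel X \<pi>)"
    by (rule transI) (auto simp: trans_rel_def intro: transition_trans)
qed

section \<open>Routing and the number of transition classes\<close>

lemma class_representatives:
  obtains r where "\<And>q. q \<in> transition_classes X \<pi> y \<Longrightarrow> r q \<in> X \<and> \<pi> (r q) = y \<and> q = trans_rel X \<pi> `` {r q}"
proof -
  have "\<forall>q\<in>transition_classes X \<pi> y. \<exists>x. x \<in> X \<and> \<pi> x = y \<and> q = trans_rel X \<pi> `` {x}"
    by (auto simp: transition_classes_def quotient_def)
  from bchoice[OF this] show thesis using that by blast
qed

definition routed :: "(int \<Rightarrow> 'a) set \<Rightarrow> int \<Rightarrow> int \<Rightarrow> (int \<Rightarrow> 'a) \<Rightarrow> bool" where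
  "routed M l n x \<longleftrightarrow> (\<exists>z\<in>X. \<pi> z = \<pi> x \<and> (\<forall>i. \<bar>i - n\<bar> > l \<longrightarrow> z i = x i) \<and> restrict z {n - R..n + R} \<in> M)"

text \<open>This is the analogue, for general codes, of a transition block of depth at most \<open>d\<close>. It is
  stated for the point \<open>y\<close> and not for a word in it; since rerouting takes place within the
  distance \<open>l\<close>, it is still decided by a neighbourhood of \<open>y\<close>.\<close>

definition routable :: "int \<Rightarrow> nat \<Rightarrow> int \<Rightarrow> (int \<Rightarrow> 'b) \<Rightarrow> bool" where
  "routable l d n y \<longleftrightarrow> (\<exists>M. finite M \<and> card M \<le> d \<and> (\<forall>x\<in>X. \<pi> x = y \<longrightarrow> routed M l n x))"

lemma restrict_window_eqD:
  assumes "restrict z {n - R..n + R} = restrict z' {n - R..n + R}" "\<bar>i - n\<bar> \<le> R"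
  shows "z i = z' i"
proof -
  have "i \<in> {n - R..n + R}" using assms(2) by auto
  then show ?thesis using assms(1) by (metis restrict_apply')
qed

text \<open>Among \<open>d + 1\<close> points over \<open>y\<close>, two can be brought to the same pattern at each routing time, by the
  pigeonhole principle, and one and the same pair for infinitely many times. At such a time either
  point of the pair can pass to the other, so the two are equivalent.\<close>

lemma frequently_routable_imp_card_classes_le:
  assumes inf: "\<exists>\<^sub>\<infinity>n. routable l d (int n) y"
  shows "finite (transition_classes X \<pi> y) \<and> card (transition_classes X \<pi> y) \<le> d"
proof (rule ccontr)
  let ?C = "transition_classes X \<pi> y"
  assume neg: "\<not> ?thesis"
  obtain T where T: "T \<subseteq> ?C" "finite T" "card T = Suc d"
  proof (cases "finite ?C")
    case True
    then show thesis using neg obtain_subset_with_card_n[of "Suc d" ?C] that by (metis not_less_eq_eq)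
  next
    case False
    then show thesis using infinite_arbitrarily_large[of ?C "Suc d"] that by blast
  qed
  obtain r where r_all: "\<And>q. q \<in> ?C \<Longrightarrow> r q \<in> X \<and> \<pi> (r q) = y \<and> q = trans_rel X \<pi> `` {r q}"
    using class_representatives by blast
  have r: "r q \<in> X" "\<pi> (r q) = y" "q = trans_rel X \<pi> `` {r q}" if "q \<in> T" for q
    using r_all that T(1) by blast+
  define P where "P n q q' \<longleftrightarrow> (\<exists>z\<in>X. \<exists>z'\<in>X. \<pi> z = y \<and> \<pi> z' = y \<and>
    (\<forall>i. \<bar>i - int n\<bar> > l \<longrightarrow> z i = r q i \<and> z' i = r q' i) \<and>
    (\<forall>i. \<bar>i - int n\<bar> \<le> R \<longrightarrow> z i = z' i))" for n q q'
  have pair: "\<forall>n\<in>{n. routable l d (int n) y}. \<exists>b\<in>{(q, q')\<in>T \<times> T. q \<noteq> q'}. P n (fst b) (snd b)"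
  proof
    fix n assume "n \<in> {n. routable l d (int n) y}"
    then obtain M where M: "finite M" "card M \<le> d" "\<forall>x\<in>X. \<pi> x = y \<longrightarrow> routed M l (int n) x"
      unfolding routable_def by auto
    have "\<forall>q\<in>T. \<exists>z\<in>X. \<pi> z = y \<and> (\<forall>i. \<bar>i - int n\<bar> > l \<longrightarrow> z i = r q i) \<and> restrict z {int n - R..int n + R} \<in> M"
      using M(3) r unfolding routed_def by metis
    then obtain z where z: "\<And>q. q \<in> T \<Longrightarrow> z q \<in> X" "\<And>q. q \<in> T \<Longrightarrow> \<pi> (z q) = y"
      "\<And>q i. q \<in> T \<Longrightarrow> \<bar>i - int n\<bar> > l \<Longrightarrow> z q i = r q i"
      "\<And>q. q \<in> T \<Longrightarrow> restrict (z q) {int n - R..int n + R} \<in> M"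
      by metis
    have "card ((\<lambda>q. restrict (z q) {int n - R..int n + R}) ` T) \<le> card M"
      using z(4) M(1) by (intro card_mono) auto
    then have "card ((\<lambda>q. restrict (z q) {int n - R..int n + R}) ` T) < card T" using M(2) T(3) by simp
    then have "\<not> inj_on (\<lambda>q. restrict (z q) {int n - R..int n + R}) T"
      by (rule pigeonhole)
    then obtain q q' where q: "q \<in> T" "q' \<in> T" "q \<noteq> q'"
      "restrict (z q) {int n - R..int n + R} = restrict (z q') {int n - R..int n + R}"
      unfolding inj_on_def by blast
    then have "P n q q'" unfolding P_def
      by (intro bexI[of _ "z q"] bexI[of _ "z q'"] conjI allI impI) (simp_all add: z restrict_window_eqD[OF q(4)])
    then show "\<exists>b\<in>{(q, q')\<in>T \<times> T. q \<noteq> q'}. P n (fst b) (snd b)" using q by force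
  qed
  \<comment> \<open>There are finitely many pairs of classes, so one pair meets at infinitely many times.\<close>
  have "\<not> finite {n. routable l d (int n) y}" using inf by (simp add: INFM_iff_infinite)
  moreover have "finite {(q, q')\<in>T \<times> T. q \<noteq> q'}"
    by (rule finite_subset[of _ "T \<times> T"]) (use T(2) in auto)
  ultimately obtain q q' where q: "q \<in> T" "q' \<in> T" "q \<noteq> q'" and
      qinf: "\<not> finite {n. routable l d (int n) y \<and> P n q q'}"
    using pigeonhole_infinite_rel[OF _ _ pair] by auto
  have trans: "transition X \<pi> (r a) (r b)"
    if ab: "a \<in> T" "b \<in> T" and ex: "\<And>k. \<exists>n>k. P n a b" for a b
    unfolding transition_def
  proof (intro conjI allI)
    fix N :: int
    obtain n where n: "n > nat (\<bar>N\<bar> + \<bar>l\<bar>)" "P n a b" using ex by blast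
    then obtain z z' where z: "z \<in> X" "z' \<in> X" "\<pi> z = y" "\<pi> z' = y"
       "\<forall>i. \<bar>i - int n\<bar> > l \<longrightarrow> z i = r a i \<and> z' i = r b i"
       "\<And>i. \<bar>i - int n\<bar> \<le> R \<Longrightarrow> z i = z' i"
      unfolding P_def by blast
    let ?w = "\<lambda>i. if i \<le> int n then z i else z' i"
    have eq: "\<pi> z' = \<pi> z" using z by simp
    have "?w \<in> X" "\<pi> ?w = \<pi> (r a)" using glue[OF z(1,2) eq z(6)] z(3) r(2) ab by auto
    moreover have "\<forall>i\<le>N. ?w i = r a i" using z(5) n(1) by auto
    moreover have "\<forall>i\<ge>int n + \<bar>l\<bar> + 1. ?w i = r b i" using z(5) by auto
    ultimately show "\<exists>z\<in>X. \<pi> z = \<pi> (r a) \<and> (\<forall>i\<le>N. z i = r a i) \<and> (\<exists>m. \<forall>i\<ge>m. z i = r b i)" by blast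
  qed (use r ab in auto)
  have ex: "\<exists>n>k. P n q q'" for k
    using qinf unfolding infinite_nat_iff_unbounded by blast
  moreover have "P n q' q" if "P n q q'" for n
    using that unfolding P_def by metis
  ultimately have "(r q, r q') \<in> trans_rel X \<pi>"
    unfolding trans_rel_def using trans[of q q'] trans[of q' q] q by blast
  then have "q = q'" using r(3) q equiv_class_eq[OF equiv_trans_rel] by metis
  then show False using q(3) by simp
qed

text \<open>The rerouted piece differs from \<open>x\<close> only within distance \<open>l\<close> of \<open>n\<close>, so it can be transplanted to
  every point that agrees with \<open>x\<close> there and on a margin of two radii: one radius for \<open>\<pi> x\<close> to be
  determined, one more for the windows across the seam.\<close>

lemma routed_cong:
  assumes "x \<in> X" "x' \<in> X" "routed M l n x" "\<And>i. \<bar>i - n\<bar> \<le> l + 2 * R \<Longrightarrow> x i = x' i" "R \<le> l"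
  shows "routed M l n x'"
proof -
  obtain z where z: "z \<in> X" "\<pi> z = \<pi> x" "\<forall>i. \<bar>i - n\<bar> > l \<longrightarrow> z i = x i" "restrict z {n - R..n + R} \<in> M"
    using assms(3) unfolding routed_def by blast
  let ?w = "\<lambda>i. if \<bar>i - n\<bar> \<le> l then z i else x' i"
  have "\<exists>u\<in>X. (\<forall>i. \<bar>i - j\<bar> \<le> R \<longrightarrow> ?w i = u i) \<and> \<pi> u j = \<pi> x' j" for j
  proof (cases "\<bar>j - n\<bar> \<le> l + R")
    case True
    have "?w i = z i" if "\<bar>i - j\<bar> \<le> R" for i
      using z(3) assms(4)[of i] True that by (auto simp: abs_le_iff)
    moreover have "\<pi> z j = \<pi> x' j"
      unfolding z(2) by (rule code_local_at) (use assms True in \<open>auto simp: abs_le_iff\<close>)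
    ultimately show ?thesis using z(1) by blast
  next
    case False
    have "?w i = x' i" if "\<bar>i - j\<bar> \<le> R" for i using False that by auto
    then show ?thesis using assms(2) by blast
  qed
  from splice[OF this] have "?w \<in> X" "\<pi> ?w = \<pi> x'" .
  moreover have "\<forall>i. \<bar>i - n\<bar> > l \<longrightarrow> ?w i = x' i" by simp
  moreover have "restrict ?w {n - R..n + R} = restrict z {n - R..n + R}"
    using assms(5) by (intro restrict_ext) auto
  ultimately show ?thesis unfolding routed_def using z(4) by auto
qed

lemma closed_not_routed:
  assumes "R \<le> l"
  shows "closed {x\<in>X. \<not> routed M l n x}"
proof -
  let ?I = "{n - (l + 2 * R)..n + (l + 2 * R)}"
  define U where "U = (\<Union>x\<in>{x\<in>X. routed M l n x}. \<Inter>i\<in>?I. {x'. x' i = x i})"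
  have "open U" unfolding U_def by (intro open_UN ballI open_INT finite_atLeastAtMost_int open_coord_eq)
  moreover have "{x\<in>X. \<not> routed M l n x} = X - U"
  proof -
    have "routed M l n x' \<longleftrightarrow> x' \<in> U" if "x' \<in> X" for x'
    proof
      show "routed M l n x' \<Longrightarrow> x' \<in> U" using that unfolding U_def by blast
      assume "x' \<in> U"
      then obtain x where x: "x \<in> X" "routed M l n x" "\<forall>i\<in>?I. x' i = x i" unfolding U_def by blast
      have "x i = x' i" if "\<bar>i - n\<bar> \<le> l + 2 * R" for i
      proof -
        have "i \<in> ?I" using that by (auto simp: abs_le_iff)
        then show ?thesis using x(3) by simp
      qed
      from routed_cong[OF x(1) that x(2) this assms] show "routed M l n x'" .
    qed
    then show ?thesis by blast
  qed
  ultimately show ?thesis using closed_X by (simp add: closed_Diff)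
qed

text \<open>Choose a representative of each class. Whether a point can leave at time \<open>0\<close> and merge with a
  given representative depends only on its pattern at \<open>0\<close>; as patterns and classes are finite in
  number, one time \<open>n\<close> serves all points: every point over \<open>y\<close> can coincide around \<open>n\<close> with the
  representative of its class, and return to itself later. The time of return is locally bounded,
  hence bounded by compactness of the fibre. So the patterns of the representatives at \<open>n\<close> are
  enough.\<close>

lemma finite_classes_imp_routable:
  assumes fin: "finite (transition_classes X \<pi> y)"
  obtains n :: nat and l where "routable l (card (transition_classes X \<pi> y)) (int n) y" "R \<le> l"
proof -
  let ?C = "transition_classes X \<pi> y"
  obtain r where r_all: "\<And>q. q \<in> ?C \<Longrightarrow> r q \<in> X \<and> \<pi> (r q) = y \<and> q = trans_rel X \<pi> `` {r q}"
    using class_representatives by blast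
  have r: "r q \<in> X" "\<pi> (r q) = y" "q = trans_rel X \<pi> `` {r q}" if "q \<in> ?C" for q
    using r_all that by blast+
  define S :: "(int \<Rightarrow> 'a) set" where "S = PiE {0 - R..0 + R} (\<lambda>_. UNIV)"
  have "finite S" unfolding S_def by (intro finite_PiE) auto
  define arr where "arr s q k \<longleftrightarrow> (\<exists>z\<in>X. \<pi> z = y \<and> restrict z {0 - R..0 + R} = s \<and> (\<forall>i\<ge>k. z i = r q i))" for s q and k :: int
  define K where "K = (\<lambda>(s, q). LEAST k::nat. arr s q (int k)) ` (S \<times> ?C)"
  have "finite K" unfolding K_def using \<open>finite S\<close> fin by blast
  have K: "arr s q (int (Max K))" if "s \<in> S" "q \<in> ?C" "arr s q k" for s q k
  proof -
    have "arr s q (int (nat k))" using that(3) unfolding arr_def by auto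
    then have "arr s q (int (LEAST k. arr s q (int k)))" by (rule LeastI)
    moreover have "(LEAST k. arr s q (int k)) \<le> Max K"
      using that \<open>finite K\<close> by (intro Max_ge) (auto simp: K_def)
    ultimately show ?thesis unfolding arr_def by (meson dual_order.trans of_nat_mono)
  qed
  \<comment> \<open>The window around \<open>n\<close> has to lie to the right of \<open>0\<close> and of all merging times.\<close>
  define n where "n = Max K + nat R + 1"
  define M where "M = (\<lambda>q. restrict (r q) {int n - R..int n + R}) ` ?C"
  have M: "finite M" "card M \<le> card ?C" unfolding M_def using fin by (auto intro: card_image_le)
  have all: "\<exists>l. routed M (int l) (int n) x" if x: "x \<in> X" "\<pi> x = y" for x
  proof -
    define q where "q = trans_rel X \<pi> `` {x}"
    have q: "q \<in> ?C" using x by (auto simp: q_def transition_classes_def quotient_def)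
    then have "(x, r q) \<in> trans_rel X \<pi>"
      using r[OF q] x unfolding q_def by (metis eq_equiv_class equiv_trans_rel)
    then have tr: "transition X \<pi> x (r q)" "transition X \<pi> (r q) x" by (auto simp: trans_rel_def)
    obtain z0 m where z0: "z0 \<in> X" "\<pi> z0 = \<pi> x" "\<forall>i\<le>R. z0 i = x i" "\<forall>i\<ge>m. z0 i = r q i"
      using tr(1) unfolding transition_def by blast
    have "arr (restrict x {0 - R..0 + R}) q m"
      unfolding arr_def by (rule bexI[of _ z0]) (use z0 x(2) in \<open>auto intro!: restrict_ext\<close>)
    from K[OF _ q this] obtain z where z: "z \<in> X" "\<pi> z = y" "restrict z {0 - R..0 + R} = restrict x {0 - R..0 + R}"
      "\<forall>i\<ge>int (Max K). z i = r q i"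
      unfolding arr_def S_def by auto
    let ?w = "\<lambda>i. if i \<le> 0 then x i else z i"
    have w: "?w \<in> X" "\<pi> ?w = y"
      using glue[of x z 0] restrict_window_eqD[OF z(3)] x z(1,2) by auto
    obtain z2 m2 where z2: "z2 \<in> X" "\<pi> z2 = \<pi> (r q)" "\<forall>i\<le>int n + R. z2 i = r q i" "\<forall>i\<ge>m2. z2 i = x i"
      using tr(2) unfolding transition_def by blast
    have eq: "\<pi> z2 = \<pi> ?w" using z2(2) r(2)[OF q] w(2) by simp
    have wr: "?w i = r q i" if "\<bar>i - int n\<bar> \<le> R" for i
      using that z(4) R_nonneg by (auto simp: n_def abs_le_iff)
    have agree: "?w i = z2 i" if "\<bar>i - int n\<bar> \<le> R" for i
      using wr[OF that] z2(3) that by (auto simp: abs_le_iff)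
    let ?v = "\<lambda>i. if i \<le> int n then ?w i else z2 i"
    have v: "?v \<in> X" "\<pi> ?v = y" using glue[OF w(1) z2(1) eq agree] w(2) by auto
    have "restrict ?v {int n - R..int n + R} = restrict (r q) {int n - R..int n + R}"
    proof (rule restrict_ext)
      fix i assume "i \<in> {int n - R..int n + R}"
      then show "?v i = r q i" using wr[of i] agree[of i] by auto
    qed
    then have "restrict ?v {int n - R..int n + R} \<in> M" unfolding M_def using q by auto
    moreover have "\<forall>i. \<bar>i - int n\<bar> > int (n + nat \<bar>m2\<bar>) \<longrightarrow> ?v i = x i" using z2(4) by auto
    ultimately have "routed M (int (n + nat \<bar>m2\<bar>)) (int n) x" unfolding routed_def
      using v x(2) by (intro bexI[of _ ?v]) simp_all
    then show ?thesis by blast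
  qed
  \<comment> \<open>The points that are not back within distance \<open>k + R\<close> form a decreasing sequence of compact sets.\<close>
  define N where "N k = {x\<in>X. \<pi> x = y \<and> \<not> routed M (int k + R) (int n) x}" for k
  have routed_mono: "routed M l (int n) x \<Longrightarrow> l \<le> l' \<Longrightarrow> routed M l' (int n) x" for l l' x
    unfolding routed_def by (meson order.strict_trans1)
  have "\<exists>k. N k = {}"
  proof (rule compact_decseq_empty[OF compact_X])
    show "closed (N k)" for k
    proof -
      have "N k = {x\<in>X. \<not> routed M (int k + R) (int n) x} \<inter> (X \<inter> \<pi> -` {y})" by (auto simp: N_def)
      moreover have "closed \<dots>"
        by (intro closed_Int closed_not_routed continuous_closed_preimage continuous_code closed_X
            compact_imp_closed_fun) auto
      ultimately show ?thesis by simp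
    qed
    show "decseq N" unfolding decseq_def N_def using routed_mono by fastforce
    show "\<Inter> (range N) = {}"
    proof (rule ccontr)
      assume "\<Inter> (range N) \<noteq> {}"
      then obtain x where x: "\<And>k. x \<in> N k" by auto
      then obtain l where "routed M (int l) (int n) x" using all[of x] by (auto simp: N_def)
      then have "routed M (int l + R) (int n) x" by (rule routed_mono) (use R_nonneg in simp)
      then show False using x[of l] by (simp add: N_def)
    qed
  qed (auto simp: N_def)
  then obtain k where "N k = {}" by blast
  then have "routable (int k + R) (card ?C) (int n) y" unfolding routable_def using M by (auto simp: N_def)
  then show thesis by (rule that) simp
qed

section \<open>Shift invariance and measurability\<close>

lemma trans_rel_shift_iff: "(shift x, shift x') \<in> trans_rel X \<pi> \<longleftrightarrow> (x, x') \<in> trans_rel X \<pi>"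
proof -
  have "transition X \<pi> (shift x) (shift x') \<longleftrightarrow> transition X \<pi> x x'" for x x'
  proof
    assume t: "transition X \<pi> x x'"
    then have X: "x \<in> X" "x' \<in> X" "\<pi> x' = \<pi> x" by (auto simp: transition_def)
    show "transition X \<pi> (shift x) (shift x')" unfolding transition_def
    proof (intro conjI allI)
      fix n
      obtain z m where z: "z \<in> X" "\<pi> z = \<pi> x" "\<forall>i\<le>n + 1. z i = x i" "\<forall>i\<ge>m. z i = x' i"
        using t unfolding transition_def by blast
      have "\<forall>i\<ge>m - 1. shift z i = shift x' i" using z(4) by (simp add: shift_def)
      then show "\<exists>z\<in>X. \<pi> z = \<pi> (shift x) \<and> (\<forall>i\<le>n. z i = shift x i) \<and> (\<exists>m. \<forall>i\<ge>m. z i = shift x' i)"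
        using z X by (intro bexI[of _ "shift z"]) (auto simp: shift_in_iff code_shift, auto simp: shift_def)
    qed (use X in \<open>auto simp: shift_in_iff code_shift\<close>)
  next
    assume t: "transition X \<pi> (shift x) (shift x')"
    then have X: "x \<in> X" "x' \<in> X" and eq: "shift (\<pi> x') = shift (\<pi> x)"
      by (auto simp: transition_def shift_in_iff code_shift)
    show "transition X \<pi> x x'" unfolding transition_def
    proof (intro conjI allI)
      show "\<pi> x' = \<pi> x" using shift_inj[OF eq] .
      fix n
      obtain z0 m where z0: "z0 \<in> X" "\<pi> z0 = \<pi> (shift x)" "\<forall>i\<le>n - 1. z0 i = shift x i" "\<forall>i\<ge>m. z0 i = shift x' i"
        using t unfolding transition_def by blast
      obtain z where z: "shift z = z0" using shift_surj by blast
      have zX: "z \<in> X" using z z0(1) shift_in_iff by blast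
      have "\<pi> z = \<pi> x" using z0(2) shift_inj unfolding z[symmetric] code_shift[OF zX] code_shift[OF X(1)] by blast
      moreover have "z i = x i" if "i \<le> n" for i using z0(3)[rule_format, of "i - 1"] that by (simp add: z[symmetric] shift_def)
      moreover have "z i = x' i" if "i \<ge> m + 1" for i using z0(4)[rule_format, of "i - 1"] that by (simp add: z[symmetric] shift_def)
      ultimately show "\<exists>z\<in>X. \<pi> z = \<pi> x \<and> (\<forall>i\<le>n. z i = x i) \<and> (\<exists>m. \<forall>i\<ge>m. z i = x' i)" using zX by blast
    qed (use X in auto)
  qed
  then show ?thesis by (auto simp: trans_rel_def)
qed

lemma routed_shift:
  assumes "x \<in> X" "routed M l (n + 1) x"
  shows "routed ((\<lambda>s. restrict (\<lambda>i. s (i + 1)) {n - R..n + R}) ` M) l n (shift x)"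
proof -
  obtain z where z: "z \<in> X" "\<pi> z = \<pi> x" "\<And>i. \<bar>i - (n + 1)\<bar> > l \<Longrightarrow> z i = x i"
      "restrict z {n + 1 - R..n + 1 + R} \<in> M"
    using assms(2) unfolding routed_def by blast
  have "shift z i = shift x i" if "\<bar>i - n\<bar> > l" for i
    unfolding shift_def by (rule z(3)) (use that in simp)
  moreover have "restrict (shift z) {n - R..n + R} \<in> (\<lambda>s. restrict (\<lambda>i. s (i + 1)) {n - R..n + R}) ` M"
    by (rule image_eqI[OF _ z(4)]) (auto simp: shift_def fun_eq_iff)
  ultimately show ?thesis
    unfolding routed_def using z(1,2) assms(1)
    by (intro bexI[of _ "shift z"]) (auto simp: shift_in_iff code_shift)
qed

lemma routed_unshift:
  assumes "x \<in> X" "routed M l n (shift x)"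
  shows "routed ((\<lambda>s. restrict (\<lambda>i. s (i - 1)) {n + 1 - R..n + 1 + R}) ` M) l (n + 1) x"
proof -
  obtain z0 where z0: "z0 \<in> X" "\<pi> z0 = \<pi> (shift x)" "\<And>i. \<bar>i - n\<bar> > l \<Longrightarrow> z0 i = shift x i"
      "restrict z0 {n - R..n + R} \<in> M"
    using assms(2) unfolding routed_def by blast
  obtain z where z: "shift z = z0" using shift_surj by blast
  have zX: "z \<in> X" using z z0(1) shift_in_iff by blast
  have "\<pi> z = \<pi> x"
    using z0(2) shift_inj unfolding z[symmetric] code_shift[OF zX] code_shift[OF assms(1)] by blast
  moreover have "z i = x i" if "\<bar>i - (n + 1)\<bar> > l" for i
    using z0(3)[of "i - 1"] that by (simp add: z[symmetric] shift_def algebra_simps)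
  moreover have "restrict z {n + 1 - R..n + 1 + R} \<in> (\<lambda>s. restrict (\<lambda>i. s (i - 1)) {n + 1 - R..n + 1 + R}) ` M"
    by (rule image_eqI[OF _ z0(4)]) (auto simp: z[symmetric] shift_def fun_eq_iff)
  ultimately show ?thesis unfolding routed_def using zX by blast
qed

lemma routable_shift_iff:
  "routable l d n (shift y) \<longleftrightarrow> routable l d (n + 1) y"
proof
  assume "routable l d n (shift y)"
  then obtain M where M: "finite M" "card M \<le> d" "\<forall>x\<in>X. \<pi> x = shift y \<longrightarrow> routed M l n x"
    unfolding routable_def by blast
  show "routable l d (n + 1) y"
    unfolding routable_def
    by (intro exI[of _ "(\<lambda>s. restrict (\<lambda>i. s (i - 1)) {n + 1 - R..n + 1 + R}) ` M"] conjI)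
      (use M in \<open>auto simp: shift_in_iff code_shift intro: order_trans[OF card_image_le] routed_unshift\<close>)
next
  assume "routable l d (n + 1) y"
  then obtain M where M: "finite M" "card M \<le> d" "\<forall>x\<in>X. \<pi> x = y \<longrightarrow> routed M l (n + 1) x"
    unfolding routable_def by blast
  have "routed ((\<lambda>s. restrict (\<lambda>i. s (i + 1)) {n - R..n + R}) ` M) l n x" if x: "x \<in> X" "\<pi> x = shift y" for x
  proof -
    obtain x' where x': "shift x' = x" using shift_surj by blast
    then have "x' \<in> X" using x(1) shift_in_iff by blast
    moreover have "\<pi> x' = y" using x(2) x' code_shift[OF \<open>x' \<in> X\<close>] shift_inj by metis
    ultimately show ?thesis using routed_shift[of x' M l n] M(3) x' by auto
  qed
  then show "routable l d n (shift y)"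
    unfolding routable_def
    by (intro exI[of _ "(\<lambda>s. restrict (\<lambda>i. s (i + 1)) {n - R..n + R}) ` M"] conjI)
      (use M in \<open>auto intro: order_trans[OF card_image_le]\<close>)
qed

lemma routable_funpow_shift: "routable l d n ((shift ^^ k) y) \<longleftrightarrow> routable l d (n + int k) y"
proof (induction k arbitrary: n)
  case (Suc k)
  show ?case by (simp add: routable_shift_iff Suc.IH algebra_simps)
qed simp

lemma closed_code_eq: "closed {x\<in>X. \<pi> x j = a}"
  using continuous_closed_preimage[OF continuous_on_product_then_coordinatewise[OF continuous_code] closed_X, of "{a}" j]
  by (simp add: vimage_def Int_def)

text \<open>Only finitely many sets \<open>M\<close> of patterns matter. For each of them the points that cannot be routed
  form a compact set, and so does its image.\<close>

lemma routable_borel: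
  assumes "R \<le> l"
  shows "{y \<in> \<pi> ` X. routable l d 0 y} \<in> sets borel"
proof -
  let ?S = "PiE {0 - R..0 + R} (\<lambda>_. UNIV :: 'a set)"
  have restrict_S: "restrict z {0 - R..0 + R} \<in> ?S" for z :: "int \<Rightarrow> 'a" by auto
  have fin: "finite ?S" by (intro finite_PiE) auto
  have meas: "\<pi> ` X - \<pi> ` {x\<in>X. \<not> routed M l 0 x} \<in> sets borel" for M
  proof -
    have "compact (\<pi> ` {x\<in>X. \<not> routed M l 0 x})"
    proof (rule compact_continuous_image)
      show "continuous_on {x\<in>X. \<not> routed M l 0 x} \<pi>" by (rule continuous_on_subset[OF continuous_code]) auto
      have "compact (X \<inter> {x\<in>X. \<not> routed M l 0 x})"
        by (rule compact_Int_closed[OF compact_X closed_not_routed[OF assms]])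
      moreover have "X \<inter> {x\<in>X. \<not> routed M l 0 x} = {x\<in>X. \<not> routed M l 0 x}" by blast
      ultimately show "compact {x\<in>X. \<not> routed M l 0 x}" by simp
    qed
    moreover have "compact (\<pi> ` X)" by (rule compact_continuous_image[OF continuous_code compact_X])
    ultimately show ?thesis by (intro sets.Diff borel_closed compact_imp_closed_fun)
  qed
  have "{y \<in> \<pi> ` X. routable l d 0 y} = (\<Union>M\<in>{M\<in>Pow ?S. card M \<le> d}. \<pi> ` X - \<pi> ` {x\<in>X. \<not> routed M l 0 x})"
  proof (intro set_eqI iffI)
    fix y assume "y \<in> {y \<in> \<pi> ` X. routable l d 0 y}"
    then obtain M where M: "y \<in> \<pi> ` X" "finite M" "card M \<le> d" "\<forall>x\<in>X. \<pi> x = y \<longrightarrow> routed M l 0 x"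
      unfolding routable_def by blast
    have "routed (M \<inter> ?S) l 0 x" if "x \<in> X" "\<pi> x = y" for x
      using M(4) that restrict_S unfolding routed_def by blast
    moreover have "card (M \<inter> ?S) \<le> d" using M(2,3) card_mono[of M "M \<inter> ?S"] by auto
    ultimately show "y \<in> (\<Union>M\<in>{M\<in>Pow ?S. card M \<le> d}. \<pi> ` X - \<pi> ` {x\<in>X. \<not> routed M l 0 x})"
      using M(1) by (intro UN_I[of "M \<inter> ?S"]) auto
  next
    fix y assume "y \<in> (\<Union>M\<in>{M\<in>Pow ?S. card M \<le> d}. \<pi> ` X - \<pi> ` {x\<in>X. \<not> routed M l 0 x})"
    then obtain M where M: "M \<subseteq> ?S" "card M \<le> d" "y \<in> \<pi> ` X" "y \<notin> \<pi> ` {x\<in>X. \<not> routed M l 0 x}" by blast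
    then have "finite M" using fin finite_subset by blast
    have "\<And>x. x \<in> X \<Longrightarrow> \<pi> x = y \<Longrightarrow> routed M l 0 x" using M(4) by blast
    then have "routable l d 0 y"
      unfolding routable_def by (intro exI[of _ M]) (simp add: M(2) \<open>finite M\<close>)
    then show "y \<in> {y \<in> \<pi> ` X. routable l d 0 y}" using M(3) by simp
  qed
  also have "\<dots> \<in> sets borel"
    by (intro sets.finite_UN meas) (use fin in auto)
  finally show ?thesis .
qed

lemma routable_by_all_windows: "routable l (card (PiE {n - R..n + R} (\<lambda>_. UNIV :: 'a set))) n y"
proof -
  have "finite (PiE {n - R..n + R} (\<lambda>_. UNIV :: 'a set))" by (intro finite_PiE) auto
  moreover have "routed (PiE {n - R..n + R} (\<lambda>_. UNIV :: 'a set)) l n x" if "x \<in> X" for x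
    unfolding routed_def using that by (intro bexI[of _ x]) auto
  ultimately show ?thesis unfolding routable_def by blast
qed

lemma closed_same_image: "closed {p. fst p \<in> X \<and> snd p \<in> X \<and> \<pi> (fst p) = \<pi> (snd p)}"
proof -
  have "{p. fst p \<in> X \<and> snd p \<in> X \<and> \<pi> (fst p) = \<pi> (snd p)} =
    (\<Inter>j. \<Union>a. {x\<in>X. \<pi> x j = a} \<times> {x\<in>X. \<pi> x j = a})"
    by (auto simp: fun_eq_iff)
  also have "closed \<dots>" by (intro closed_INT ballI closed_UN closed_Times closed_code_eq) auto
  finally show ?thesis .
qed

text \<open>If the path from \<open>x\<close> to \<open>x'\<close> has to leave \<open>x\<close> after \<open>n\<close> and to arrive at \<open>x'\<close> before \<open>m\<close>, then the
  triples of path, source and target form a compact set; its projection \<open>K n m\<close> is closed, and the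
  transition relation is \<open>\<Inter>n. \<Union>m. K n m\<close>.\<close>

lemma trans_rel_borel: "trans_rel X \<pi> \<in> sets borel"
proof -
  define E where "E = {p. fst p \<in> X \<and> snd p \<in> X \<and> \<pi> (fst p) = \<pi> (snd p)}"
  define A where "A I = {p :: (int \<Rightarrow> 'a) \<times> (int \<Rightarrow> 'a). \<forall>i\<in>I. fst p i = snd p i}" for I
  define f1 :: "(int \<Rightarrow> 'a) \<times> (int \<Rightarrow> 'a) \<times> (int \<Rightarrow> 'a) \<Rightarrow> (int \<Rightarrow> 'a) \<times> (int \<Rightarrow> 'a)"
    where "f1 = (\<lambda>t. (fst t, fst (snd t)))"
  define f2 :: "(int \<Rightarrow> 'a) \<times> (int \<Rightarrow> 'a) \<times> (int \<Rightarrow> 'a) \<Rightarrow> (int \<Rightarrow> 'a) \<times> (int \<Rightarrow> 'a)"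
    where "f2 = (\<lambda>t. (fst t, snd (snd t)))"
  have cont: "continuous_on UNIV f1" "continuous_on UNIV f2"
    unfolding f1_def f2_def by (intro continuous_intros)+
  define K where "K n m = snd ` (f1 -` E \<inter> f2 -` E \<inter> f1 -` A {..n} \<inter> f2 -` A {m..})" for n m :: int
  have closed_K: "closed (K n m)" for n m
  proof -
    have "compact (UNIV :: ((int \<Rightarrow> 'a) \<times> (int \<Rightarrow> 'a) \<times> (int \<Rightarrow> 'a)) set)"
      using compact_Times[OF compact_UNIV_seq compact_Times[OF compact_UNIV_seq compact_UNIV_seq]] by simp
    moreover have "closed (f1 -` E \<inter> f2 -` E \<inter> f1 -` A {..n} \<inter> f2 -` A {m..})"
      unfolding E_def A_def by (intro closed_Int closed_vimage closed_same_image closed_agree cont)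
    ultimately have "compact (f1 -` E \<inter> f2 -` E \<inter> f1 -` A {..n} \<inter> f2 -` A {m..})"
      using compact_Int_closed by fastforce
    then have "compact (K n m)" unfolding K_def by (intro compact_continuous_image continuous_intros)
    moreover have "Hausdorff_space (euclidean :: ((int \<Rightarrow> 'a) \<times> (int \<Rightarrow> 'a)) topology)"
      unfolding prod_topology_euclidean[symmetric] Hausdorff_space_prod_topology
      using Hausdorff_euclidean_fun[OF Hausdorff_euclidean_t2] by blast
    ultimately show ?thesis using compact_imp_closed_Hausdorff by blast
  qed
  define T where "T = (\<Inter>n. \<Union>m. K n m)"
  have T: "T \<in> sets borel" unfolding T_def
    by (intro sets.countable_INT'' sets.countable_UN'' borel_closed closed_K) auto
  have T_iff: "p \<in> T \<longleftrightarrow> transition X \<pi> (fst p) (snd p)" for p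
  proof -
    have K_iff: "(x, x') \<in> K n m \<longleftrightarrow> x \<in> X \<and> x' \<in> X \<and> \<pi> x' = \<pi> x \<and>
        (\<exists>z\<in>X. \<pi> z = \<pi> x \<and> (\<forall>i\<le>n. z i = x i) \<and> (\<forall>i\<ge>m. z i = x' i))" for x x' n m
    proof
      assume "(x, x') \<in> K n m"
      then obtain z where z: "(z, x) \<in> E" "(z, x') \<in> E" "(z, x) \<in> A {..n}" "(z, x') \<in> A {m..}"
        unfolding K_def f1_def f2_def by auto
      then have "z \<in> X" "\<pi> z = \<pi> x" "\<forall>i\<le>n. z i = x i" "\<forall>i\<ge>m. z i = x' i" "x \<in> X" "x' \<in> X" "\<pi> x' = \<pi> x"
        unfolding E_def A_def by auto
      then show "x \<in> X \<and> x' \<in> X \<and> \<pi> x' = \<pi> x \<and>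
        (\<exists>z\<in>X. \<pi> z = \<pi> x \<and> (\<forall>i\<le>n. z i = x i) \<and> (\<forall>i\<ge>m. z i = x' i))" by blast
    next
      assume r: "x \<in> X \<and> x' \<in> X \<and> \<pi> x' = \<pi> x \<and>
        (\<exists>z\<in>X. \<pi> z = \<pi> x \<and> (\<forall>i\<le>n. z i = x i) \<and> (\<forall>i\<ge>m. z i = x' i))"
      then obtain z where z: "z \<in> X" "\<pi> z = \<pi> x" "\<forall>i\<le>n. z i = x i" "\<forall>i\<ge>m. z i = x' i" by blast
      have "(z, x) \<in> E" "(z, x') \<in> E" "(z, x) \<in> A {..n}" "(z, x') \<in> A {m..}"
        using r z unfolding E_def A_def by auto
      then have "(z, x, x') \<in> f1 -` E \<inter> f2 -` E \<inter> f1 -` A {..n} \<inter> f2 -` A {m..}"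
        unfolding f1_def f2_def by auto
      then show "(x, x') \<in> K n m" unfolding K_def by (metis image_eqI snd_conv)
    qed
    obtain x x' where p: "p = (x, x')" by fastforce
    show ?thesis unfolding p T_def transition_def by (simp add: K_iff) blast
  qed
  have "trans_rel X \<pi> = T \<inter> prod.swap -` T"
    by (auto simp: trans_rel_def T_iff)
  moreover have "prod.swap -` T \<in> sets (borel :: ((int \<Rightarrow> 'a) \<times> (int \<Rightarrow> 'a)) measure)"
  proof -
    have "(prod.swap :: (int \<Rightarrow> 'a) \<times> (int \<Rightarrow> 'a) \<Rightarrow> _) \<in> borel_measurable borel"
      by (rule borel_measurable_continuous_onI) (rule continuous_on_swap)
    from measurable_sets[OF this T] show ?thesis by simp
  qed
  ultimately show ?thesis using T by simp
qed

end

section \<open>Invariant and ergodic measures\<close>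

lemma invariant_measureD:
  assumes "invariant_measure M T"
  shows "prob_space M" "T \<in> measurable M M" "distr M M T = M"
  using assms by (auto simp: invariant_measure_def)

lemma measurable_funpow:
  assumes "T \<in> measurable M M"
  shows "(T ^^ n) \<in> measurable M M"
  by (rule measurable_compose_n[OF assms])

lemma invariant_measure_funpow:
  assumes "invariant_measure M T"
  shows "invariant_measure M (T ^^ n)"
proof -
  note T = invariant_measureD[OF assms]
  have "distr M M (T ^^ n) = M"
  proof (induction n)
    case 0
    then show ?case by (simp add: distr_id id_def)
  next
    case (Suc n)
    have "distr M M (T ^^ Suc n) = distr (distr M M (T ^^ n)) M T"
      using T(2) measurable_funpow[OF T(2), of n] by (simp add: distr_distr)
    then show ?case by (simp only: Suc T(3))
  qed
  then show ?thesis unfolding invariant_measure_def using T measurable_funpow by blast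
qed

lemma invariant_emeasure_vimage:
  assumes "invariant_measure M T" "A \<in> sets M"
  shows "emeasure M (T -` A \<inter> space M) = emeasure M A"
  using emeasure_distr[OF invariant_measureD(2)[OF assms(1)] assms(2)] invariant_measureD(3)[OF assms(1)] by simp

lemma AE_funpow:
  assumes "invariant_measure M T" "AE x in M. P x"
  shows "AE x in M. P ((T ^^ n) x)"
proof -
  note T = invariant_measureD[OF invariant_measure_funpow[OF assms(1), of n]]
  have "AE x in distr M M (T ^^ n). P x" unfolding T(3) by (rule assms(2))
  from AE_distrD[OF T(2) this] show ?thesis .
qed

text \<open>The set of points that visit \<open>A\<close> infinitely often is strictly invariant, and it has at least the
  measure of \<open>A\<close>, as a decreasing limit of sets that contain preimages of \<open>A\<close>.\<close>

lemma ergodic_recurrence: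
  assumes "ergodic_measure M T" "A \<in> sets M" "emeasure M A \<noteq> 0"
  shows "AE x in M. \<exists>\<^sub>\<infinity>n. (T ^^ n) x \<in> A"
proof -
  have inv: "invariant_measure M T" using assms(1) by (simp add: ergodic_measure_def)
  interpret prob_space M using invariant_measureD[OF inv] by simp
  have T: "T \<in> measurable M M" using invariant_measureD[OF inv] by simp
  define D where "D k = (\<Union>n\<in>{k..}. (T ^^ n) -` A \<inter> space M)" for k
  have sets_D: "D k \<in> sets M" for k
    unfolding D_def by (intro sets.countable_UN'' measurable_sets[OF measurable_funpow[OF T] assms(2)]) auto
  define V where "V = (\<Inter>k. D k)"
  have sets_V: "V \<in> sets M" unfolding V_def using sets_D by auto
  have V_iff: "x \<in> V \<longleftrightarrow> x \<in> space M \<and> (\<exists>\<^sub>\<infinity>n. (T ^^ n) x \<in> A)" for x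
    unfolding V_def D_def INFM_nat_le by auto
  have "emeasure M A \<le> emeasure M (D k)" for k
  proof -
    have "emeasure M A = emeasure M ((T ^^ k) -` A \<inter> space M)"
      by (rule invariant_emeasure_vimage[OF invariant_measure_funpow[OF inv] assms(2), symmetric])
    also have "\<dots> \<le> emeasure M (D k)"
      by (rule emeasure_mono[OF _ sets_D]) (auto simp: D_def)
    finally show ?thesis .
  qed
  then have "emeasure M A \<le> (INF k. emeasure M (D k))" by (rule INF_greatest)
  also have "\<dots> = emeasure M V"
    unfolding V_def
  proof (rule INF_emeasure_decseq)
    show "decseq D" unfolding decseq_def D_def by (intro allI impI UN_mono) auto
  qed (use sets_D in auto)
  finally have "emeasure M V \<noteq> 0" using assms(3) by auto
  moreover have "T -` V \<inter> space M = V"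
  proof -
    have "T x \<in> V \<longleftrightarrow> x \<in> V" if "x \<in> space M" for x
    proof -
      have "(\<exists>\<^sub>\<infinity>n. (T ^^ n) (T x) \<in> A) \<longleftrightarrow> (\<exists>\<^sub>\<infinity>n. (T ^^ Suc n) x \<in> A)"
        by (simp add: funpow_swap1)
      also have "\<dots> \<longleftrightarrow> (\<exists>\<^sub>\<infinity>n. (T ^^ n) x \<in> A)"
        using eventually_sequentially_Suc[of "\<lambda>n. (T ^^ n) x \<notin> A"]
        unfolding frequently_def cofinite_eq_sequentially by simp
      finally show ?thesis using that measurable_space[OF T] by (auto simp: V_iff)
    qed
    moreover have "V \<subseteq> space M" using V_iff by blast
    ultimately show ?thesis by blast
  qed
  ultimately have "emeasure M V = 1"
    using assms(1) sets_V unfolding ergodic_measure_def by blast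
  then have "AE x in M. x \<in> V" using sets_V by (simp add: emeasure_eq_measure AE_in_set_eq_1)
  then show ?thesis by eventually_elim (simp add: V_iff)
qed

lemma density_less_one_null:
  assumes "prob_space M" and h: "h \<in> borel_measurable M" and P: "P \<in> sets M"
    and less: "\<And>x. x \<in> P \<Longrightarrow> h x < (1::ennreal)"
    and le: "emeasure M P \<le> emeasure (density M h) P"
  shows "emeasure M P = 0"
proof -
  interpret prob_space M by fact
  have ind: "(\<integral>\<^sup>+x. h x * indicator P x \<partial>M) \<le> (\<integral>\<^sup>+x. indicator P x \<partial>M)"
    by (rule nn_integral_mono) (use less in \<open>auto simp: indicator_def less_imp_le\<close>)
  also have "\<dots> < \<infinity>" using P by (simp add: emeasure_eq_measure)
  finally have fin: "(\<integral>\<^sup>+x. h x * indicator P x \<partial>M) \<noteq> \<infinity>" by simp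
  have "(\<integral>\<^sup>+x. (1 - h x) * indicator P x \<partial>M) = (\<integral>\<^sup>+x. indicator P x - h x * indicator P x \<partial>M)"
    by (rule nn_integral_cong) (auto simp: indicator_def)
  also have "\<dots> = (\<integral>\<^sup>+x. indicator P x \<partial>M) - (\<integral>\<^sup>+x. h x * indicator P x \<partial>M)"
    by (rule nn_integral_diff) (use h P fin less in \<open>auto simp: indicator_def less_imp_le\<close>)
  also have "\<dots> = 0"
    using le h P by (simp add: emeasure_density diff_eq_0_ennreal emeasure_eq_measure)
  finally have "AE x in M. (1 - h x) * indicator P x = 0"
    using h P by (subst (asm) nn_integral_0_iff_AE) auto
  then have "AE x in M. x \<notin> P"
  proof eventually_elim
    case (elim x)
    then show ?case using less[of x] by (auto simp: indicator_def diff_eq_0_iff_ennreal split: if_splits)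
  qed
  then show ?thesis using P by (simp add: AE_iff_null_sets null_setsD1)
qed

text \<open>Let \<open>h\<close> be the density of \<open>N\<close>, \<open>A = {h < 1}\<close> and \<open>B\<close> the preimage of \<open>A\<close>. Invariance gives \<open>A - B\<close> and
  \<open>B - A\<close> equal mass, for \<open>M\<close> as well as for \<open>N\<close>. On the first set \<open>N\<close> is smaller than \<open>M\<close>, on the
  second it is not, so both are null: almost no point outside \<open>A\<close> ever enters \<open>A\<close>. If \<open>A\<close> had positive
  measure, recurrence would make it conull, whereas \<open>h\<close> has mean \<open>1\<close>. Hence \<open>h \<ge> 1\<close> almost everywhere,
  which forces equality.\<close>

lemma ergodic_measure_extremal:
  assumes erg: "ergodic_measure M T" and N: "invariant_measure N T"
    and sets_eq: "sets N = sets M" and ac: "absolutely_continuous M N"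
  shows "N = M"
proof -
  have inv: "invariant_measure M T" using erg by (simp add: ergodic_measure_def)
  interpret M: prob_space M using invariant_measureD[OF inv] by simp
  interpret N: prob_space N using invariant_measureD[OF N] by simp
  have space_eq: "space N = space M" using sets_eq by (rule sets_eq_imp_space_eq)
  have T: "T \<in> measurable M M" using invariant_measureD[OF inv] by simp
  define h where "h = RN_deriv M N"
  have h: "h \<in> borel_measurable M" unfolding h_def by simp
  have dens: "density M h = N" unfolding h_def by (rule M.density_RN_deriv[OF ac sets_eq])
  have Nh: "emeasure N E = (\<integral>\<^sup>+x. h x * indicator E x \<partial>M)" if "E \<in> sets M" for E
    using emeasure_density[OF h that] dens by simp
  define A where "A = {x\<in>space M. h x < 1}"
  have A: "A \<in> sets M" unfolding A_def using h by measurable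
  define B where "B = T -` A \<inter> space M"
  have B: "B \<in> sets M" unfolding B_def using T A by (rule measurable_sets)
  have eq: "emeasure M B = emeasure M A" "emeasure N B = emeasure N A"
    using invariant_emeasure_vimage[OF inv A] invariant_emeasure_vimage[OF N, of A] A sets_eq space_eq
    by (auto simp: B_def)
  have diff: "measure K (A - B) = measure K (B - A)"
    if K: "finite_measure K" "sets K = sets M" "emeasure K B = emeasure K A" for K
  proof -
    interpret K: finite_measure K by fact
    have "measure K (A - B) = measure K A - measure K (A \<inter> B)" "measure K (B - A) = measure K B - measure K (A \<inter> B)"
      using A B K(2) K.finite_measure_Diff'[of A B] K.finite_measure_Diff'[of B A] by (simp_all add: Int_commute)
    then show ?thesis using K(3) by (simp add: K.emeasure_eq_measure)
  qed
  have ge: "emeasure M E \<le> emeasure N E" if "E \<in> sets M" "AE x in M. x \<in> E \<longrightarrow> 1 \<le> h x" for E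
  proof -
    have "emeasure M E = (\<integral>\<^sup>+x. indicator E x \<partial>M)" using that by simp
    also have "\<dots> \<le> (\<integral>\<^sup>+x. h x * indicator E x \<partial>M)"
      by (rule nn_integral_mono_AE) (use that(2) in \<open>eventually_elim, auto simp: indicator_def\<close>)
    finally show ?thesis by (simp add: Nh that)
  qed
  have "emeasure M (B - A) \<le> emeasure N (B - A)"
    by (rule ge) (use A B in \<open>auto simp: A_def B_def not_less\<close>)
  then have "emeasure M (A - B) \<le> emeasure N (A - B)"
    using diff[of M] diff[of N] M.finite_measure_axioms N.finite_measure_axioms eq sets_eq
    by (simp add: M.emeasure_eq_measure N.emeasure_eq_measure)
  then have "emeasure M (A - B) = 0"
    by (intro density_less_one_null[of M h]) (use A B h dens M.prob_space_axioms in \<open>auto simp: A_def\<close>)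
  then have "emeasure M (B - A) = 0"
    using diff[of M] M.finite_measure_axioms eq by (simp add: M.emeasure_eq_measure)
  then have "AE x in M. x \<notin> B - A" using A B by (intro AE_not_in null_setsI) auto
  then have "AE x in M. \<forall>n. (T ^^ n) x \<notin> B - A"
    unfolding AE_all_countable using AE_funpow[OF inv] by blast
  moreover have "AE x in M. \<forall>n. (T ^^ n) x \<in> space M"
    using measurable_space[OF measurable_funpow[OF T]] by (intro AE_I2) blast
  ultimately have out: "AE x in M. x \<notin> A \<longrightarrow> (\<forall>n. (T ^^ n) x \<notin> A)"
  proof eventually_elim
    case (elim x)
    have "(T ^^ n) x \<notin> A" if "x \<notin> A" for n
    proof (induction n)
      case (Suc n)
      then have "(T ^^ n) x \<notin> B" using elim by blast
      then show ?case using elim(2)[rule_format, of n] by (simp add: B_def)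
    qed (use that in simp)
    then show ?case by blast
  qed
  have "emeasure M A = 0"
  proof (rule ccontr)
    assume pos: "emeasure M A \<noteq> 0"
    have "AE x in M. x \<in> A"
      using out ergodic_recurrence[OF erg A pos]
      by eventually_elim (auto simp: INFM_nat_le)
    moreover from this have "AE x in N. x \<in> A"
      using ac sets_eq absolutely_continuous_AE[OF sets_eq] by blast
    ultimately have "emeasure M A = 1" "emeasure N A = 1"
      using A sets_eq by (simp_all add: M.AE_in_set_eq_1 N.AE_in_set_eq_1 M.emeasure_eq_measure N.emeasure_eq_measure)
    then have "emeasure M A = 0"
      by (intro density_less_one_null[of M h]) (use A h dens M.prob_space_axioms in \<open>auto simp: A_def\<close>)
    then show False using pos by simp
  qed
  then have "AE x in M. x \<notin> A" using A by (intro AE_not_in null_setsI)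
  then have h1: "AE x in M. 1 \<le> h x"
    using AE_space by eventually_elim (auto simp: A_def not_less)
  show "N = M"
  proof (rule measure_eqI[OF sets_eq])
    fix E assume "E \<in> sets N"
    then have E: "E \<in> sets M" using sets_eq by simp
    have "emeasure M E' \<le> emeasure N E'" if "E' \<in> sets M" for E'
      by (rule ge[OF that]) (use h1 in \<open>eventually_elim, simp\<close>)
    from this[of E] this[of "space M - E"] E
    have "measure M E \<le> measure N E" "measure M (space M - E) \<le> measure N (space M - E)"
      by (simp_all add: M.emeasure_eq_measure N.emeasure_eq_measure)
    moreover have "measure M (space M - E) = 1 - measure M E" "measure N (space M - E) = 1 - measure N E"
      using M.prob_compl[OF E] N.prob_compl[of E] E sets_eq space_eq by simp_all
    ultimately show "emeasure N E = emeasure M E"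
      by (simp add: M.emeasure_eq_measure N.emeasure_eq_measure)
  qed
qed

section \<open>The almost sure number of transition classes\<close>

context local_code
begin

text \<open>Let \<open>c\<close> be least such that routing through \<open>c\<close> patterns, within some distance, has positive
  probability; it exists because the set of all patterns always serves. Recurrence gives the upper
  bound. Fewer classes would make some shift of \<open>y\<close> routable through fewer than \<open>c\<close> patterns, which
  happens with probability \<open>0\<close>.\<close>

theorem AE_card_transition_classes:
  assumes erg: "ergodic_measure_on (\<pi> ` X) \<nu>"
  shows "AE y in \<nu>. finite (transition_classes X \<pi> y) \<and> card (transition_classes X \<pi> y) = class_degree X \<pi> \<nu>"
proof -
  let ?Y = "\<pi> ` X" and ?C = "transition_classes X \<pi>"
  have sets: "sets \<nu> = sets (borel_on ?Y)" and erg': "ergodic_measure \<nu> shift"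
    using erg by (auto simp: ergodic_measure_on_def)
  have inv: "invariant_measure \<nu> shift" using erg' by (simp add: ergodic_measure_def)
  interpret prob_space \<nu> using invariant_measureD[OF inv] by simp
  have space: "space \<nu> = ?Y"
    using sets_eq_imp_space_eq[OF sets] by (simp add: borel_on_def space_restrict_space)
  have "closed ?Y"
    using compact_continuous_image[OF continuous_code compact_X] by (rule compact_imp_closed_fun)
  define U where "U l d = {y \<in> ?Y. routable l d 0 y}" for l d
  have U: "U l d \<in> sets \<nu>" if "R \<le> l" for l d
    using routable_borel[OF that, of d] \<open>closed ?Y\<close>
    by (simp add: sets borel_on_def U_def sets_restrict_space_iff)
  define Q where "Q d \<longleftrightarrow> (\<exists>l\<ge>R. emeasure \<nu> (U l d) \<noteq> 0)" for d
  define c where "c = (LEAST d. Q d)"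
  have "\<exists>d. Q d"
  proof -
    have "U R (card (PiE {0 - R..0 + R} (\<lambda>_. UNIV :: 'a set))) = space \<nu>"
      using routable_by_all_windows[of R 0] by (auto simp: U_def space)
    then show ?thesis unfolding Q_def using emeasure_space_1 by (metis order_refl zero_neq_one)
  qed
  then have "Q c" unfolding c_def by (rule LeastI_ex)
  then obtain l where l: "l \<ge> R" "emeasure \<nu> (U l c) \<noteq> 0" unfolding Q_def by blast
  have null: "AE y in \<nu>. y \<notin> U k d" if "d < c" "k \<ge> R" for d k
  proof -
    have "\<not> Q d" using that(1) unfolding c_def by (rule not_less_Least)
    then have "emeasure \<nu> (U k d) = 0" using that(2) by (auto simp: Q_def)
    then show ?thesis using U[OF that(2), of d] by (intro AE_not_in null_setsI)
  qed
  have "AE y in \<nu>. \<forall>d\<in>{..<c}. \<forall>k\<in>{R..}. \<forall>n. (shift ^^ n) y \<notin> U k d"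
    unfolding AE_ball_countable[OF countable_finite[OF finite_lessThan]] AE_ball_countable[OF countableI_type] AE_all_countable
    using AE_funpow[OF inv null] by simp
  moreover have "AE y in \<nu>. \<exists>\<^sub>\<infinity>n. (shift ^^ n) y \<in> U l c"
    by (rule ergodic_recurrence[OF erg' U[OF l(1)] l(2)])
  ultimately have AE_c: "AE y in \<nu>. finite (?C y) \<and> card (?C y) = c"
    using AE_space
  proof eventually_elim
    case (elim y)
    have "\<exists>\<^sub>\<infinity>n. routable l c (int n) y"
      using elim(2) by (rule INFM_mono) (simp add: U_def routable_funpow_shift)
    from frequently_routable_imp_card_classes_le[OF this]
    have le: "finite (?C y)" "card (?C y) \<le> c" by auto
    obtain n :: nat and k where k: "routable k (card (?C y)) (int n) y" "R \<le> k"
      using finite_classes_imp_routable[OF le(1)] by blast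
    have "(shift ^^ n) y \<in> ?Y"
      using measurable_space[OF measurable_funpow[OF invariant_measureD(2)[OF inv]] elim(3), of n] space by simp
    then have "(shift ^^ n) y \<in> U k (card (?C y))" using k(1) by (simp add: U_def routable_funpow_shift)
    then have "\<not> card (?C y) < c" using elim(1) k(2) by auto
    then show ?case using le by simp
  qed
  have "class_degree X \<pi> \<nu> = c"
    unfolding class_degree_def
  proof (rule the_equality)
    show "AE y in \<nu>. finite (?C y) \<and> card (?C y) = c" by (rule AE_c)
    fix c' assume "AE y in \<nu>. finite (?C y) \<and> card (?C y) = c'"
    with AE_c have "AE y in \<nu>. c' = c" by eventually_elim simp
    then show "c' = c" by simp
  qed
  then show ?thesis using AE_c by simp
qed

end

section \<open>Measures as limits of set functions on clopen sets\<close>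

definition clopens :: "'x::topological_space set \<Rightarrow> 'x set set" where
  "clopens \<Omega> = {E. E \<subseteq> \<Omega> \<and> closed E \<and> closed (\<Omega> - E)}"

lemma clopensI: "E \<subseteq> \<Omega> \<Longrightarrow> closed E \<Longrightarrow> closed (\<Omega> - E) \<Longrightarrow> E \<in> clopens \<Omega>"
  by (simp add: clopens_def)

lemma clopens_Diff: "E \<in> clopens \<Omega> \<Longrightarrow> \<Omega> - E \<in> clopens \<Omega>"
  by (auto simp: clopens_def double_diff)

lemma clopens_Un: "E \<in> clopens \<Omega> \<Longrightarrow> F \<in> clopens \<Omega> \<Longrightarrow> E \<union> F \<in> clopens \<Omega>"
proof -
  assume E: "E \<in> clopens \<Omega>" "F \<in> clopens \<Omega>"
  have "\<Omega> - (E \<union> F) = (\<Omega> - E) \<inter> (\<Omega> - F)" by blast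
  then show ?thesis using E by (simp add: clopens_def closed_Un closed_Int)
qed

lemma clopens_Int: "E \<in> clopens \<Omega> \<Longrightarrow> F \<in> clopens \<Omega> \<Longrightarrow> E \<inter> F \<in> clopens \<Omega>"
proof -
  assume E: "E \<in> clopens \<Omega>" "F \<in> clopens \<Omega>"
  have "\<Omega> - (E \<inter> F) = (\<Omega> - E) \<union> (\<Omega> - F)" by blast
  then show ?thesis using E by (auto simp: clopens_def closed_Un closed_Int)
qed

lemma clopens_empty: "closed \<Omega> \<Longrightarrow> {} \<in> clopens \<Omega>" and clopens_whole: "closed \<Omega> \<Longrightarrow> \<Omega> \<in> clopens \<Omega>"
  by (simp_all add: clopens_def)

lemma clopens_Pow: "clopens \<Omega> \<subseteq> Pow \<Omega>" by (auto simp: clopens_def)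

lemma algebra_clopens: "closed \<Omega> \<Longrightarrow> algebra \<Omega> (clopens \<Omega>)"
  by (simp add: algebra_iff_Un clopens_Pow clopens_empty clopens_Diff clopens_Un)

lemma clopens_vimage:
  assumes "continuous_on UNIV f" "closed \<Omega>'" "E \<in> clopens \<Omega>" "f ` \<Omega>' \<subseteq> \<Omega>"
  shows "f -` E \<inter> \<Omega>' \<in> clopens \<Omega>'"
proof (rule clopensI)
  have "\<Omega>' - (f -` E \<inter> \<Omega>') = f -` (\<Omega> - E) \<inter> \<Omega>'" using assms(4) by blast
  then show "closed (\<Omega>' - (f -` E \<inter> \<Omega>'))"
    using assms by (simp add: clopens_def closed_Int closed_vimage)
  show "closed (f -` E \<inter> \<Omega>')" using assms by (simp add: clopens_def closed_Int closed_vimage)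
qed simp

text \<open>Clopen sets are closed under intersection, so they determine a finite measure on the
  \<open>\<sigma>\<close>-algebra that they generate.\<close>

lemma measure_eqI_clopens:
  fixes M N :: "'x::topological_space measure"
  assumes "closed \<Omega>" "sets M = sigma_sets \<Omega> (clopens \<Omega>)" "sets N = sigma_sets \<Omega> (clopens \<Omega>)"
    and "finite_measure M" and "\<And>E. E \<in> clopens \<Omega> \<Longrightarrow> emeasure M E = emeasure N E"
  shows "M = N"
proof (rule measure_eqI_generator_eq[of "clopens \<Omega>" \<Omega> M N "\<lambda>_. \<Omega>"])
  show "Int_stable (clopens \<Omega>)" by (simp add: Int_stable_def clopens_Int)
  show "emeasure M \<Omega> \<noteq> \<infinity>" using finite_measure.emeasure_finite[OF assms(4)] by simp
qed (simp_all add: assms clopens_Pow clopens_whole)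

text \<open>By compactness a decreasing sequence of clopen sets with empty intersection is eventually empty,
  so finite additivity is enough for the Caratheodory extension theorem.\<close>

lemma clopens_measure_extension:
  fixes \<Omega> :: "'x::topological_space set" and m :: "'x set \<Rightarrow> real"
  assumes \<Omega>: "compact \<Omega>" "closed \<Omega>"
    and nonneg: "\<And>E. E \<in> clopens \<Omega> \<Longrightarrow> 0 \<le> m E"
    and add: "\<And>E F. E \<in> clopens \<Omega> \<Longrightarrow> F \<in> clopens \<Omega> \<Longrightarrow> E \<inter> F = {} \<Longrightarrow> m (E \<union> F) = m E + m F"
  obtains M where "sets M = sigma_sets \<Omega> (clopens \<Omega>)" "\<And>E. E \<in> clopens \<Omega> \<Longrightarrow> emeasure M E = ennreal (m E)"
proof -
  interpret algebra \<Omega> "clopens \<Omega>" by (rule algebra_clopens[OF \<Omega>(2)])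
  let ?f = "\<lambda>E. ennreal (m E)"
  have m0: "m {} = 0" using add[of "{}" "{}"] clopens_empty[OF \<Omega>(2)] by simp
  have "\<exists>\<mu>. (\<forall>s\<in>clopens \<Omega>. \<mu> s = ?f s) \<and> measure_space \<Omega> (sigma_sets \<Omega> (clopens \<Omega>)) \<mu>"
  proof (rule caratheodory_empty_continuous)
    show "positive (clopens \<Omega>) ?f" by (simp add: positive_def m0)
    show "additive (clopens \<Omega>) ?f"
      unfolding additive_def using add nonneg by (auto simp: ennreal_plus)
    fix A :: "nat \<Rightarrow> 'x set"
    assume A: "range A \<subseteq> clopens \<Omega>" "decseq A" "\<Inter> (range A) = {}"
    have "closed (A n)" "A n \<subseteq> \<Omega>" for n using A(1) by (auto simp: clopens_def)
    then obtain N where N: "A N = {}"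
      using compact_decseq_empty[OF \<Omega>(1) _ _ A(2,3)] by blast
    have "A n = {}" if "n \<ge> N" for n using decseqD[OF A(2) that] N by auto
    then have "eventually (\<lambda>n. ?f (A n) = 0) sequentially"
      unfolding eventually_sequentially using m0 by (metis ennreal_0)
    then show "(\<lambda>n. ?f (A n)) \<longlonglongrightarrow> 0" by (rule tendsto_eventually)
  qed simp
  then obtain \<mu> where \<mu>: "\<forall>s\<in>clopens \<Omega>. \<mu> s = ?f s" "measure_space \<Omega> (sigma_sets \<Omega> (clopens \<Omega>)) \<mu>"
    by blast
  define M where "M = measure_of \<Omega> (clopens \<Omega>) \<mu>"
  have sets_M: "sets M = sigma_sets \<Omega> (clopens \<Omega>)" unfolding M_def by (simp add: clopens_Pow)
  have "emeasure M E = ?f E" if "E \<in> clopens \<Omega>" for E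
  proof -
    have "emeasure M E = \<mu> E"
      by (rule emeasure_measure_of[OF M_def clopens_Pow])
        (use \<mu>(2) that in \<open>auto simp: sets_M measure_space_def\<close>)
    then show ?thesis using \<mu>(1) that by simp
  qed
  then show thesis by (rule that[OF sets_M])
qed

lemma compact_unit_functions: "compact {h :: 'i \<Rightarrow> real. \<forall>i. h i \<in> {0..1}}"
proof -
  have "compactin (product_topology (\<lambda>_. euclidean) UNIV) (PiE (UNIV :: 'i set) (\<lambda>_. {0..1::real}))"
    unfolding compactin_PiE by simp
  moreover have "PiE (UNIV :: 'i set) (\<lambda>_. {0..1::real}) = {h. \<forall>i. h i \<in> {0..1}}"
    by (auto simp: PiE_def Pi_def)
  ultimately show ?thesis by (simp add: euclidean_product_topology)
qed

text \<open>Weak sequential compactness in a form that asks for no convergent subsequence: the set functions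
  lie in the compact space \<open>[0, 1]\<close> to the power of all sets, so they have a cluster point. Each
  condition on finitely many values that is closed and eventually true for the sequence holds for the
  cluster point; the conclusion records the conditions on differences of two values.\<close>

lemma clopens_cluster_measure:
  fixes \<Omega> :: "'x::topological_space set" and f :: "nat \<Rightarrow> 'x set \<Rightarrow> real"
  assumes \<Omega>: "compact \<Omega>" "closed \<Omega>"
    and f01: "\<And>n E. 0 \<le> f n E \<and> f n E \<le> 1"
    and add: "\<And>n E F. E \<in> clopens \<Omega> \<Longrightarrow> F \<in> clopens \<Omega> \<Longrightarrow> E \<inter> F = {} \<Longrightarrow> f n (E \<union> F) = f n E + f n F"
    and one: "\<And>n. f n \<Omega> = 1"
  obtains M where "prob_space M" "sets M = sigma_sets \<Omega> (clopens \<Omega>)"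
    "\<And>E F r. E \<in> clopens \<Omega> \<Longrightarrow> F \<in> clopens \<Omega> \<Longrightarrow> (\<lambda>n. f n E - f n F) \<longlonglongrightarrow> r \<Longrightarrow> measure M E - measure M F = r"
proof -
  let ?F = "filtermap f sequentially"
  have "?F \<noteq> bot" by (simp add: filtermap_bot_iff)
  moreover have "eventually (\<lambda>h. h \<in> {h. \<forall>i. h i \<in> {0..1}}) ?F"
    by (simp add: eventually_filtermap f01)
  ultimately obtain m where m: "m \<in> {h. \<forall>i. h i \<in> {0..1}}" "inf (nhds m) ?F \<noteq> bot"
    using compact_unit_functions[unfolded compact_filter] by blast
  \<comment> \<open>Closed conditions pass to the cluster point; the rest of the proof only applies this.\<close>
  have closed_in: "m \<in> C" if "closed C" "eventually (\<lambda>n. f n \<in> C) sequentially" for C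
  proof (rule ccontr)
    assume "m \<notin> C"
    then have "eventually (\<lambda>h. h \<in> - C) (nhds m)"
      using that(1) by (intro eventually_nhds_in_open) auto
    moreover have "eventually (\<lambda>h. h \<in> C) ?F" using that(2) by (simp add: eventually_filtermap)
    ultimately have "eventually (\<lambda>h. False) (inf (nhds m) ?F)"
      unfolding eventually_inf by (metis ComplD)
    then show False using m(2) by (simp add: eventually_False)
  qed
  have m_add: "m (E \<union> F) = m E + m F" if "E \<in> clopens \<Omega>" "F \<in> clopens \<Omega>" "E \<inter> F = {}" for E F
  proof -
    have "closed {h :: 'x set \<Rightarrow> real. h (E \<union> F) = h E + h F}"
      by (intro closed_Collect_eq continuous_on_add continuous_on_product_coordinates)
    from closed_in[OF this] show ?thesis using add[OF that] by simp
  qed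
  have m_diff: "m E - m F = r" if "(\<lambda>n. f n E - f n F) \<longlonglongrightarrow> r" for E F r
  proof -
    have "\<bar>m E - m F - r\<bar> \<le> e" if "e > 0" for e
    proof -
      have "closed {h :: 'x set \<Rightarrow> real. \<bar>h E - h F - r\<bar> \<le> e}"
        by (intro closed_Collect_le continuous_on_rabs continuous_on_diff continuous_on_const continuous_on_product_coordinates)
      moreover have "eventually (\<lambda>n. \<bar>f n E - f n F - r\<bar> \<le> e) sequentially"
        using tendstoD[OF \<open>(\<lambda>n. f n E - f n F) \<longlonglongrightarrow> r\<close> \<open>e > 0\<close>]
        by eventually_elim (simp add: dist_real_def)
      ultimately show ?thesis using closed_in[of "{h. \<bar>h E - h F - r\<bar> \<le> e}"] by simp
    qed
    then have "\<bar>m E - m F - r\<bar> \<le> 0" by (rule field_le_epsilon) simp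
    then show ?thesis by simp
  qed
  have m_one: "m \<Omega> = 1"
    using closed_in[of "{h. h \<Omega> = 1}"] one
      closed_Collect_eq[OF continuous_on_product_coordinates continuous_on_const, of \<Omega> "1::real"] by simp
  obtain M where M: "sets M = sigma_sets \<Omega> (clopens \<Omega>)" "\<And>E. E \<in> clopens \<Omega> \<Longrightarrow> emeasure M E = ennreal (m E)"
    using clopens_measure_extension[OF \<Omega>, of m] m(1) m_add by auto
  have space_M: "space M = \<Omega>"
    using sets_eq_imp_space_eq[of M "sigma \<Omega> (clopens \<Omega>)"] M(1) clopens_Pow[of \<Omega>] by simp
  have "prob_space M"
    by (rule prob_spaceI) (use M(2)[OF clopens_whole[OF \<Omega>(2)]] in \<open>simp add: space_M m_one\<close>)
  moreover have "measure M E - measure M F = r"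
    if "E \<in> clopens \<Omega>" "F \<in> clopens \<Omega>" "(\<lambda>n. f n E - f n F) \<longlonglongrightarrow> r" for E F r
    using m_diff[OF that(3)] M(2)[OF that(1)] M(2)[OF that(2)] m(1) by (simp add: measure_def)
  ultimately show thesis using that M(1) by blast
qed

section \<open>Couplings over a finite partition\<close>

text \<open>The integrand is the density, with respect to the product of \<open>L\<close> and \<open>L'\<close>, of the coupling that
  makes the two points independent given that they lie in the same cell of the partition. The
  inner integral cancels the weight, except on cells of measure \<open>0\<close>.\<close>

lemma fibrewise_coupling_marginal:
  assumes "prob_space L" "prob_space L'" and S: "finite S"
    and W: "W \<in> measurable L (count_space S)" and W': "W' \<in> measurable L' (count_space S)"
    and eq: "distr L (count_space S) W = distr L' (count_space S) W'"
    and A: "A \<in> sets L"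
  shows "(\<integral>\<^sup>+x. \<integral>\<^sup>+x'. (if W x = W' x' then inverse (emeasure L (W -` {W x} \<inter> space L)) else 0) * indicator A x \<partial>L' \<partial>L) = emeasure L A"
proof -
  interpret L: prob_space L by fact
  interpret L': prob_space L' by fact
  define p where "p w = emeasure L (W -` {w} \<inter> space L)" for w
  have p': "p w = emeasure L' (W' -` {w} \<inter> space L')" if "w \<in> S" for w
    unfolding p_def using emeasure_distr[OF W, of "{w}"] emeasure_distr[OF W', of "{w}"] eq that by simp
  have sets_w: "W -` {w} \<inter> space L \<in> sets L" "W' -` {w} \<inter> space L' \<in> sets L'" if "w \<in> S" for w
    using measurable_sets[OF W, of "{w}"] measurable_sets[OF W', of "{w}"] that by auto
  have inner: "(\<integral>\<^sup>+x'. (if W x = W' x' then inverse (p (W x)) else 0) * indicator A x \<partial>L')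
      = inverse (p (W x)) * p (W x) * indicator A x" if x: "x \<in> space L" for x
  proof -
    have w: "W x \<in> S" using measurable_space[OF W x] by simp
    have "(\<integral>\<^sup>+x'. (if W x = W' x' then inverse (p (W x)) else 0) * indicator A x \<partial>L')
      = (\<integral>\<^sup>+x'. (inverse (p (W x)) * indicator A x) * indicator (W' -` {W x} \<inter> space L') x' \<partial>L')"
      by (rule nn_integral_cong) (auto simp: indicator_def)
    also have "\<dots> = (inverse (p (W x)) * indicator A x) * p (W x)"
      using sets_w[OF w] by (simp add: nn_integral_cmult_indicator p'[OF w])
    finally show ?thesis by (simp add: mult_ac)
  qed
  have "AE x in L. \<forall>w\<in>S. p w = 0 \<longrightarrow> W x \<noteq> w"
  proof (rule AE_finite_allI[OF S])
    fix w assume w: "w \<in> S"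
    show "AE x in L. p w = 0 \<longrightarrow> W x \<noteq> w"
    proof (cases "p w = 0")
      case True
      then have "AE x in L. x \<notin> W -` {w} \<inter> space L"
        using sets_w[OF w] by (intro AE_not_in null_setsI) (simp_all add: p_def)
      then show ?thesis using AE_space by eventually_elim auto
    qed simp
  qed
  then have one: "AE x in L. inverse (p (W x)) * p (W x) * indicator A x = indicator A x"
    using AE_space
  proof eventually_elim
    case (elim x)
    have "p (W x) \<noteq> 0" using elim measurable_space[OF W, of x] by auto
    moreover have "p (W x) \<noteq> top" unfolding p_def by simp
    ultimately have "inverse (p (W x)) * p (W x) = 1"
      by (metis ennreal_divide_self divide_ennreal_def mult.commute less_top)
    then show ?case by simp
  qed
  have "(\<integral>\<^sup>+x. \<integral>\<^sup>+x'. (if W x = W' x' then inverse (p (W x)) else 0) * indicator A x \<partial>L' \<partial>L)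
     = (\<integral>\<^sup>+x. inverse (p (W x)) * p (W x) * indicator A x \<partial>L)"
    by (rule nn_integral_cong) (rule inner)
  also have "\<dots> = (\<integral>\<^sup>+x. indicator A x \<partial>L)" by (rule nn_integral_cong_AE[OF one])
  also have "\<dots> = emeasure L A" using A by simp
  finally show ?thesis unfolding p_def .
qed

text \<open>The density is symmetric in the two measures because they give each cell the same mass, so one
  computation serves for both marginals.\<close>

lemma coupling_over_finite_partition:
  assumes "prob_space L" "prob_space L'" and S: "finite S"
    and W: "W \<in> measurable L (count_space S)" and W': "W' \<in> measurable L' (count_space S)"
    and eq: "distr L (count_space S) W = distr L' (count_space S) W'"
  obtains Q where "prob_space Q" "sets Q = sets (L \<Otimes>\<^sub>M L')" "distr Q L fst = L" "distr Q L' snd = L'"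
    "AE z in Q. W (fst z) = W' (snd z)"
proof -
  interpret L: prob_space L by fact
  interpret L': prob_space L' by fact
  interpret P: pair_prob_space L L' ..
  define p where "p w = emeasure L (W -` {w} \<inter> space L)" for w
  have p': "p w = emeasure L' (W' -` {w} \<inter> space L')" if "w \<in> S" for w
    unfolding p_def using emeasure_distr[OF W, of "{w}"] emeasure_distr[OF W', of "{w}"] eq that by simp
  define h where "h z = (if W (fst z) = W' (snd z) then inverse (p (W (fst z))) else 0)" for z
  define G where "G = (\<lambda>q :: 'c \<times> 'c. if fst q = snd q then inverse (p (fst q)) else (0 :: ennreal))"
  have meas: "(\<lambda>z. (W (fst z), W' (snd z))) \<in> measurable (L \<Otimes>\<^sub>M L') (count_space S \<Otimes>\<^sub>M count_space S)"
    using W W' by measurable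
  have "G \<in> borel_measurable (count_space S \<Otimes>\<^sub>M count_space S)"
    using S by (simp add: pair_measure_countable countable_finite)
  from measurable_compose[OF meas this] have h: "h \<in> borel_measurable (L \<Otimes>\<^sub>M L')"
    by (simp only: h_def[abs_def] G_def fst_conv snd_conv)
  define Q where "Q = density (L \<Otimes>\<^sub>M L') h"
  have sets_Q: "sets Q = sets (L \<Otimes>\<^sub>M L')" by (simp add: Q_def)
  have fst_m: "fst \<in> measurable Q L" and snd_m: "snd \<in> measurable Q L'" by (simp_all add: Q_def)
  have fst_eq: "emeasure (distr Q L fst) A = emeasure L A" if A: "A \<in> sets L" for A
  proof -
    have "emeasure (distr Q L fst) A = emeasure Q (fst -` A \<inter> space Q)"
      by (rule emeasure_distr[OF fst_m A])
    also have "\<dots> = (\<integral>\<^sup>+z. h z * indicator (fst -` A \<inter> space Q) z \<partial>(L \<Otimes>\<^sub>M L'))"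
      unfolding Q_def using measurable_sets[OF fst_m A] by (intro emeasure_density h) (simp add: Q_def)
    also have "\<dots> = (\<integral>\<^sup>+z. h z * indicator A (fst z) \<partial>(L \<Otimes>\<^sub>M L'))"
      by (rule nn_integral_cong) (auto simp: indicator_def Q_def)
    also have "\<dots> = (\<integral>\<^sup>+x. \<integral>\<^sup>+x'. h (x, x') * indicator A x \<partial>L' \<partial>L)"
      using h A by (subst L'.nn_integral_fst[symmetric]) auto
    also have "\<dots> = emeasure L A"
      using fibrewise_coupling_marginal[OF assms A] by (simp only: h_def p_def fst_conv snd_conv)
    finally show ?thesis .
  qed
  have snd_eq: "emeasure (distr Q L' snd) A = emeasure L' A" if A: "A \<in> sets L'" for A
  proof -
    have "emeasure (distr Q L' snd) A = emeasure Q (snd -` A \<inter> space Q)"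
      by (rule emeasure_distr[OF snd_m A])
    also have "\<dots> = (\<integral>\<^sup>+z. h z * indicator (snd -` A \<inter> space Q) z \<partial>(L \<Otimes>\<^sub>M L'))"
      unfolding Q_def using measurable_sets[OF snd_m A] by (intro emeasure_density h) (simp add: Q_def)
    also have "\<dots> = (\<integral>\<^sup>+z. h z * indicator A (snd z) \<partial>(L \<Otimes>\<^sub>M L'))"
      by (rule nn_integral_cong) (auto simp: indicator_def Q_def)
    also have "\<dots> = (\<integral>\<^sup>+x'. \<integral>\<^sup>+x. h (x, x') * indicator A x' \<partial>L \<partial>L')"
      using h A by (subst P.nn_integral_snd[symmetric]) (auto simp: split_beta')
    also have "\<dots> = (\<integral>\<^sup>+x'. \<integral>\<^sup>+x. (if W' x' = W x then inverse (emeasure L' (W' -` {W' x'} \<inter> space L')) else 0) * indicator A x' \<partial>L \<partial>L')"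
      using p'[OF measurable_space[OF W, simplified]] by (intro nn_integral_cong) (auto simp: h_def)
    also have "\<dots> = emeasure L' A"
      by (rule fibrewise_coupling_marginal[OF assms(2,1) S W' W eq[symmetric] A])
    finally show ?thesis .
  qed
  have d1: "distr Q L fst = L" by (rule measure_eqI) (simp_all add: fst_eq)
  have d2: "distr Q L' snd = L'" by (rule measure_eqI) (simp_all add: snd_eq)
  have "prob_space Q"
    using L.prob_space_axioms d1 prob_space_distrD[OF fst_m] by simp
  moreover have "AE z in Q. W (fst z) = W' (snd z)"
    unfolding Q_def by (subst AE_density[OF h]) (simp add: h_def)
  ultimately show thesis using that sets_Q d1 d2 by blast
qed

section \<open>Powers of a closed set of sequences\<close>

lemma closed_pow_space:
  fixes X :: "(int \<Rightarrow> 'a::alphabet) set"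
  assumes "closed X"
  shows "closed (PiE {1..n::nat} (\<lambda>_. X))"
proof -
  have "PiE {1..n} (\<lambda>_. X) = (\<Inter>i\<in>{1..n}. (\<lambda>x. x i) -` X) \<inter> (\<Inter>i\<in>- {1..n}. (\<lambda>x. x i) -` {undefined})"
    by (auto simp: PiE_def extensional_def Pi_def)
  moreover have "closed ((\<lambda>x :: nat \<Rightarrow> int \<Rightarrow> 'a. x i) -` C)" if "closed C" for i C
    by (rule closed_vimage[OF that continuous_on_product_coordinates])
  moreover have "closed {undefined :: int \<Rightarrow> 'a}" by (rule compact_imp_closed_fun) simp
  ultimately show ?thesis using assms by (auto intro!: closed_Int closed_INT)
qed

lemma compact_pow_space:
  fixes X :: "(int \<Rightarrow> 'a::alphabet) set"
  assumes "closed X"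
  shows "compact (PiE {1..n::nat} (\<lambda>_. X))"
  using compact_Int_closed[OF compact_UNIV_fun[OF compact_UNIV_seq] closed_pow_space[OF assms, of n]] by simp

lemma space_borel_on [simp]: "space (borel_on X) = X"
  by (simp add: borel_on_def space_restrict_space)

lemma space_borel_pow [simp]: "space (borel_pow X n) = PiE {1..n} (\<lambda>_. X)"
  by (simp add: borel_pow_def space_PiM)

lemma measurable_borel_pow_component:
  "i \<in> {1..n} \<Longrightarrow> (\<lambda>x. x i) \<in> measurable (borel_pow X n) (borel_on X)"
  unfolding borel_pow_def by (rule measurable_component_singleton)

lemma measurable_borel_on_borel: "f \<in> measurable M (borel_on X) \<Longrightarrow> f \<in> borel_measurable M"
  unfolding borel_on_def by (simp add: measurable_restrict_space2_iff)

lemma measurable_alphabet: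
  fixes f :: "'s \<Rightarrow> 'a::alphabet"
  assumes "\<And>a. {x\<in>space M. f x = a} \<in> sets M"
  shows "f \<in> borel_measurable M"
proof (rule measurableI)
  fix A :: "'a set"
  have "f -` A \<inter> space M = (\<Union>a\<in>A. {x\<in>space M. f x = a})" by blast
  also have "\<dots> \<in> sets M" by (intro sets.finite_UN assms) simp
  finally show "f -` A \<inter> space M \<in> sets M" .
qed simp

lemma sets_Collect_eq_alphabet:
  fixes f g :: "'s \<Rightarrow> 'a::alphabet"
  assumes "f \<in> borel_measurable M" "g \<in> borel_measurable M"
  shows "{x\<in>space M. f x = g x} \<in> sets M"
proof -
  have "{x\<in>space M. f x = g x} = (\<Union>a. (f -` {a} \<inter> space M) \<inter> (g -` {a} \<inter> space M))" by auto
  also have "\<dots> \<in> sets M"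
    by (intro sets.finite_UN sets.Int measurable_sets[OF assms(1)] measurable_sets[OF assms(2)]) simp_all
  finally show ?thesis .
qed

text \<open>Cylinders are clopen and generate the product \<open>\<sigma>\<close>-algebra. This is where measures on powers of
  \<open>X\<close> meet the construction of measures from clopen sets.\<close>

lemma sets_borel_pow_clopens:
  fixes X :: "(int \<Rightarrow> 'a::alphabet) set"
  assumes "closed X"
  shows "sets (borel_pow X n) = sigma_sets (PiE {1..n} (\<lambda>_. X)) (clopens (PiE {1..n} (\<lambda>_. X)))"
    (is "_ = sigma_sets ?\<Omega> _")
proof
  let ?N = "sigma ?\<Omega> (clopens ?\<Omega>)"
  have sets_N: "sets ?N = sigma_sets ?\<Omega> (clopens ?\<Omega>)" and space_N: "space ?N = ?\<Omega>"
    by (simp_all add: clopens_Pow)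
  have cl: "closed {x\<in>?\<Omega>. x i j = a}" for i j a
  proof -
    have "closed ((\<lambda>x :: nat \<Rightarrow> int \<Rightarrow> 'a. x i j) -` {a})"
      by (intro closed_vimage continuous_on_product_then_coordinatewise[OF continuous_on_product_coordinates]) simp
    moreover have "{x\<in>?\<Omega>. x i j = a} = (\<lambda>x. x i j) -` {a} \<inter> ?\<Omega>" by blast
    ultimately show ?thesis by (simp only: closed_Int closed_pow_space[OF assms])
  qed
  have clopen: "{x\<in>?\<Omega>. x i j = a} \<in> clopens ?\<Omega>" for i j a
  proof (rule clopensI)
    have "?\<Omega> - {x\<in>?\<Omega>. x i j = a} = (\<Union>b\<in>- {a}. {x\<in>?\<Omega>. x i j = b})" by blast
    also have "closed \<dots>" by (intro closed_UN cl ballI) simp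
    finally show "closed (?\<Omega> - {x\<in>?\<Omega>. x i j = a})" .
  qed (use cl in auto)
  have coord: "(\<lambda>x. x i) \<in> borel_measurable ?N" for i
    by (rule measurable_coordinatewise_then_product, rule measurable_alphabet)
      (simp only: space_N sets_N, rule sigma_sets.Basic[OF clopen])
  show "sets (borel_pow X n) \<subseteq> sigma_sets ?\<Omega> (clopens ?\<Omega>)"
    unfolding borel_pow_def sets_N[symmetric]
  proof (rule sets_PiM_in_sets)
    show "space ?N = (\<Pi>\<^sub>E i\<in>{1..n}. space (borel_on X))" by (simp only: space_N space_borel_on)
    fix i A assume i: "i \<in> {1..n}" "A \<in> sets (borel_on X)"
    then obtain B where B: "B \<in> sets borel" "A = X \<inter> B" by (auto simp: borel_on_def sets_restrict_space)
    have "{x\<in>space ?N. x i \<in> A} = (\<lambda>x. x i) -` B \<inter> space ?N"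
      using i(1) unfolding space_N B(2) by (auto simp: PiE_def Pi_def)
    then show "{x\<in>space ?N. x i \<in> A} \<in> sets ?N" using measurable_sets[OF coord B(1)] by simp
  qed
  have comp: "(\<lambda>x. x i) \<in> borel_measurable (borel_pow X n)" for i
  proof (cases "i \<in> {1..n}")
    case True
    show ?thesis by (rule measurable_borel_on_borel[OF measurable_borel_pow_component[OF True]])
  next
    case False
    have "(\<lambda>x. x i) \<in> borel_measurable (borel_pow X n) \<longleftrightarrow>
        (\<lambda>x. undefined :: int \<Rightarrow> 'a) \<in> borel_measurable (borel_pow X n)"
      using False by (intro measurable_cong) (auto simp: PiE_def extensional_def)
    then show ?thesis by simp
  qed
  have id: "(\<lambda>x. x) \<in> borel_measurable (borel_pow X n)"
    by (rule measurable_coordinatewise_then_product) (rule comp)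
  have "clopens ?\<Omega> \<subseteq> sets (borel_pow X n)"
  proof
    fix E assume E: "E \<in> clopens ?\<Omega>"
    then have "(\<lambda>x. x) -` E \<inter> space (borel_pow X n) \<in> sets (borel_pow X n)"
      by (intro measurable_sets[OF id] borel_closed) (simp add: clopens_def)
    moreover have "(\<lambda>x. x) -` E \<inter> space (borel_pow X n) = E" using E by (auto simp: clopens_def)
    ultimately show "E \<in> sets (borel_pow X n)" by simp
  qed
  then show "sigma_sets ?\<Omega> (clopens ?\<Omega>) \<subseteq> sets (borel_pow X n)"
    using sets.sigma_sets_subset[of "clopens ?\<Omega>" "borel_pow X n"] by simp
qed

lemma continuous_shift: "continuous_on UNIV (shift :: (int \<Rightarrow> 'a::topological_space) \<Rightarrow> _)"
  unfolding shift_def by (intro continuous_on_coordinatewise_then_product continuous_on_product_coordinates)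

lemma continuous_shift_pow: "continuous_on UNIV (shift_pow n :: (nat \<Rightarrow> int \<Rightarrow> 'a::topological_space) \<Rightarrow> _)"
proof (rule continuous_on_coordinatewise_then_product)
  fix i
  show "continuous_on UNIV (\<lambda>x :: nat \<Rightarrow> int \<Rightarrow> 'a. shift_pow n x i)"
  proof (cases "i \<in> {1..n}")
    case True
    then show ?thesis
      using continuous_on_compose2[OF continuous_shift continuous_on_product_coordinates[of i]]
      by (simp add: shift_pow_def)
  next
    case False
    then have "(\<lambda>x :: nat \<Rightarrow> int \<Rightarrow> 'a. shift_pow n x i) = (\<lambda>_. undefined)"
      by (auto simp: shift_pow_def fun_eq_iff)
    then show ?thesis by (rule ssubst) (rule continuous_on_const)
  qed
qed

text \<open>Projections to blocks of coordinates and permutations of coordinates are both of this form, so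
  they share one proof that pushforwards of relative joinings are relative joinings.\<close>

definition reindex :: "nat \<Rightarrow> (nat \<Rightarrow> nat) \<Rightarrow> (nat \<Rightarrow> 's) \<Rightarrow> nat \<Rightarrow> 's" where
  "reindex m \<sigma> x = (\<lambda>i\<in>{1..m}. x (\<sigma> i))"

lemma continuous_reindex: "continuous_on UNIV (reindex m \<sigma> :: (nat \<Rightarrow> int \<Rightarrow> 'a::topological_space) \<Rightarrow> _)"
proof (rule continuous_on_coordinatewise_then_product)
  fix i
  show "continuous_on UNIV (\<lambda>x :: nat \<Rightarrow> int \<Rightarrow> 'a. reindex m \<sigma> x i)"
  proof (cases "i \<in> {1..m}")
    case True
    then show ?thesis by (simp add: reindex_def continuous_on_product_coordinates)
  next
    case False
    then have "(\<lambda>x :: nat \<Rightarrow> int \<Rightarrow> 'a. reindex m \<sigma> x i) = (\<lambda>_. undefined)"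
      by (auto simp: reindex_def fun_eq_iff)
    then show ?thesis by (rule ssubst) (rule continuous_on_const)
  qed
qed

lemma reindex_PiE: "\<sigma> \<in> {1..m} \<rightarrow> {1..n} \<Longrightarrow> x \<in> PiE {1..n} (\<lambda>_. X) \<Longrightarrow> reindex m \<sigma> x \<in> PiE {1..m} (\<lambda>_. X)"
  by (auto simp: reindex_def PiE_def Pi_def)

lemma measurable_reindex:
  assumes "\<sigma> \<in> {1..m} \<rightarrow> {1..n}"
  shows "reindex m \<sigma> \<in> measurable (borel_pow X n) (borel_pow X m)"
  unfolding reindex_def borel_pow_def[of X m]
  by (rule measurable_restrict) (use assms in \<open>auto intro!: measurable_borel_pow_component\<close>)

lemma reindex_shift_pow:
  "\<sigma> \<in> {1..m} \<rightarrow> {1..n} \<Longrightarrow> reindex m \<sigma> (shift_pow n x) = shift_pow m (reindex m \<sigma> x)"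
  by (auto simp: reindex_def shift_pow_def fun_eq_iff Pi_def)

lemma reindex_shift_pow_funpow:
  "\<sigma> \<in> {1..m} \<rightarrow> {1..n} \<Longrightarrow> reindex m \<sigma> ((shift_pow n ^^ k) x) = (shift_pow m ^^ k) (reindex m \<sigma> x)"
  by (induction k) (simp_all add: reindex_shift_pow)

lemma shift_pow_funpow_apply:
  "i \<in> {1..n} \<Longrightarrow> (shift_pow n ^^ k) x i = (shift ^^ k) (x i)"
  by (induction k arbitrary: i) (simp_all add: shift_pow_def)

lemma shift_funpow_apply: "(shift ^^ k) x j = x (j + int k)"
  by (induction k arbitrary: j) (simp_all add: shift_def algebra_simps)

context local_code
begin

section \<open>Relative joinings\<close>

lemma shift_pow_PiE: "x \<in> PiE {1..n} (\<lambda>_. X) \<Longrightarrow> shift_pow n x \<in> PiE {1..n} (\<lambda>_. X)"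
  by (auto simp: shift_pow_def PiE_def Pi_def shift_in_iff)

lemma measurable_shift_pow: "shift_pow n \<in> measurable (borel_pow X n) (borel_pow X n)"
proof -
  have s: "shift \<in> measurable (borel_on X) (borel_on X)"
    unfolding borel_on_def
  proof (rule measurable_restrict_space3)
    show "shift \<in> borel_measurable borel" by (rule borel_measurable_continuous_onI[OF continuous_shift])
  qed (simp add: shift_in_iff)
  show ?thesis
    unfolding shift_pow_def borel_pow_def[of X n]
  proof (rule measurable_restrict)
    fix i assume "i \<in> {1..n}"
    then show "(\<lambda>x. shift (x i)) \<in> measurable (PiM {1..n} (\<lambda>_. borel_on X)) (borel_on X)"
      using measurable_compose[OF measurable_borel_pow_component s, unfolded borel_pow_def] by blast
  qed
qed

lemma code_shift_funpow: "x \<in> X \<Longrightarrow> (shift ^^ k) x \<in> X \<and> \<pi> ((shift ^^ k) x) = (shift ^^ k) (\<pi> x)"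
  by (induction k) (simp_all add: shift_in_iff code_shift)

lemma measurable_code: "\<pi> \<in> measurable (borel_on X) (borel_on (\<pi> ` X))"
  unfolding borel_on_def[of "\<pi> ` X"]
proof (rule measurable_restrict_space2)
  show "\<pi> \<in> borel_measurable (borel_on X)"
    unfolding borel_on_def by (rule borel_measurable_continuous_on_restrict[OF continuous_code])
qed auto

lemma relative_joiningD:
  assumes "relative_joining X \<pi> n L"
  shows "sets L = sets (borel_pow X n)" "invariant_measure L (shift_pow n)"
    "AE x in L. \<forall>i\<in>{1..n}. \<forall>j\<in>{1..n}. \<pi> (x i) = \<pi> (x j)" "prob_space L" "space L = PiE {1..n} (\<lambda>_. X)"
proof -
  show s: "sets L = sets (borel_pow X n)" and "invariant_measure L (shift_pow n)"
    and "AE x in L. \<forall>i\<in>{1..n}. \<forall>j\<in>{1..n}. \<pi> (x i) = \<pi> (x j)"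
    using assms by (auto simp: relative_joining_def)
  then show "prob_space L" by (simp add: invariant_measureD)
  show "space L = PiE {1..n} (\<lambda>_. X)" using sets_eq_imp_space_eq[OF s] by simp
qed

lemma relative_joining_overD:
  assumes "relative_joining_over X (\<pi> ` X) \<pi> \<nu> n L"
  shows "relative_joining X \<pi> n L" "1 \<le> n"
  using assms by (auto simp: relative_joining_over_def)

lemma measurable_code_component:
  assumes "sets L = sets (borel_pow X n)" "i \<in> {1..n}"
  shows "(\<lambda>x. \<pi> (x i)) \<in> measurable L (borel_on (\<pi> ` X))"
  using measurable_compose[OF measurable_borel_pow_component[OF assms(2)] measurable_code]
    measurable_cong_sets[OF assms(1) refl] by blast

lemma relative_joining_over_image:
  assumes L: "relative_joining_over X (\<pi> ` X) \<pi> \<nu> n L" and i: "i \<in> {1..n}"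
  shows "distr L (borel_on (\<pi> ` X)) (\<lambda>x. \<pi> (x i)) = \<nu>"
proof -
  note D = relative_joiningD[OF relative_joining_overD(1)[OF L]]
  obtain k where k: "k \<in> {1..n}" "distr (distr L (borel_on X) (\<lambda>x. x k)) (borel_on (\<pi> ` X)) \<pi> = \<nu>"
    using L unfolding relative_joining_over_def by blast
  have "(\<lambda>x. x k) \<in> measurable L (borel_on X)"
    using measurable_borel_pow_component[OF k(1)] measurable_cong_sets[OF D(1) refl] by blast
  from distr_distr[OF measurable_code this]
  have "distr L (borel_on (\<pi> ` X)) (\<lambda>x. \<pi> (x k)) = \<nu>"
    using k(2) by (simp add: comp_def)
  moreover have "distr L (borel_on (\<pi> ` X)) (\<lambda>x. \<pi> (x i)) = distr L (borel_on (\<pi> ` X)) (\<lambda>x. \<pi> (x k))"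
  proof (rule distr_cong_AE)
    show "AE x in L. \<pi> (x i) = \<pi> (x k)" using D(3) by eventually_elim (use i k in blast)
  qed (use measurable_code_component[OF D(1)] i k in auto)
  ultimately show ?thesis by simp
qed

lemma relative_joining_over_intro:
  assumes L: "relative_joining X \<pi> n L" and i: "i \<in> {1..n}"
    and \<nu>: "distr L (borel_on (\<pi> ` X)) (\<lambda>x. \<pi> (x i)) = \<nu>"
  shows "relative_joining_over X (\<pi> ` X) \<pi> \<nu> n L"
proof -
  have s: "sets L = sets (borel_pow X n)" using L by (simp add: relative_joining_def)
  have "(\<lambda>x. x i) \<in> measurable L (borel_on X)"
    using measurable_borel_pow_component[OF i] measurable_cong_sets[OF s refl] by blast
  from distr_distr[OF measurable_code this]
  have "distr (distr L (borel_on X) (\<lambda>x. x i)) (borel_on (\<pi> ` X)) \<pi> = \<nu>"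
    using \<nu> by (simp add: comp_def)
  then show ?thesis unfolding relative_joining_over_def using L i by blast
qed

lemma measurable_reindex':
  assumes "sets L = sets (borel_pow X n)" "\<sigma> \<in> {1..m} \<rightarrow> {1..n}"
  shows "reindex m \<sigma> \<in> measurable L (borel_pow X m)"
  using measurable_reindex[OF assms(2), of X] measurable_cong_sets[OF assms(1) refl] by blast

lemma relative_joining_reindex:
  assumes L: "relative_joining X \<pi> n L" and \<sigma>: "\<sigma> \<in> {1..m} \<rightarrow> {1..n}"
  shows "relative_joining X \<pi> m (distr L (borel_pow X m) (reindex m \<sigma>))"
proof -
  note D = relative_joiningD[OF L]
  let ?D = "distr L (borel_pow X m) (reindex m \<sigma>)"
  have r: "reindex m \<sigma> \<in> measurable L (borel_pow X m)"
    by (rule measurable_reindex'[OF D(1) \<sigma>])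
  have inv: "invariant_measure ?D (shift_pow m)"
    unfolding invariant_measure_def
  proof (intro conjI)
    show "prob_space ?D" by (rule prob_space.prob_space_distr[OF D(4) r])
    show t: "shift_pow m \<in> measurable ?D ?D" using measurable_shift_pow by simp
    note T = invariant_measureD[OF D(2)]
    have "distr ?D ?D (shift_pow m) = distr ?D (borel_pow X m) (shift_pow m)"
      by (rule distr_cong) auto
    also have "\<dots> = distr L (borel_pow X m) (shift_pow m \<circ> reindex m \<sigma>)"
      by (rule distr_distr[OF measurable_shift_pow r])
    also have "shift_pow m \<circ> reindex m \<sigma> = reindex m \<sigma> \<circ> shift_pow n"
      by (rule ext) (simp add: reindex_shift_pow[OF \<sigma>])
    also have "distr L (borel_pow X m) \<dots> = distr (distr L L (shift_pow n)) (borel_pow X m) (reindex m \<sigma>)"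
      by (rule distr_distr[symmetric, OF r T(2)])
    finally show "distr ?D ?D (shift_pow m) = ?D" by (simp add: T(3))
  qed
  have "AE x in ?D. \<forall>i\<in>{1..m}. \<forall>j\<in>{1..m}. \<pi> (x i) = \<pi> (x j)"
  proof -
    have "AE x in ?D. \<pi> (x i) = \<pi> (x j)" if ij: "i \<in> {1..m}" "j \<in> {1..m}" for i j
    proof (subst AE_distr_iff[OF r])
      have "{x\<in>space (borel_pow X m). \<forall>k. \<pi> (x i) k = \<pi> (x j) k} \<in> sets (borel_pow X m)"
      proof (rule sets.sets_Collect_countable_All)
        fix k
        have coord: "(\<lambda>x. \<pi> (x i) k) \<in> borel_measurable (borel_pow X m)" if "i \<in> {1..m}" for i
          using measurable_borel_on_borel[OF measurable_code_component[OF refl that]]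
          by (rule measurable_product_then_coordinatewise)
        show "{x\<in>space (borel_pow X m). \<pi> (x i) k = \<pi> (x j) k} \<in> sets (borel_pow X m)"
          using coord[OF ij(1)] coord[OF ij(2)] by (rule sets_Collect_eq_alphabet)
      qed
      then show "{x\<in>space (borel_pow X m). \<pi> (x i) = \<pi> (x j)} \<in> sets (borel_pow X m)"
        by (simp add: fun_eq_iff)
      show "AE x in L. \<pi> (reindex m \<sigma> x i) = \<pi> (reindex m \<sigma> x j)"
        using D(3) by eventually_elim (use \<sigma> ij in \<open>auto simp: reindex_def Pi_def\<close>)
    qed
    then have "\<forall>i\<in>{1..m}. \<forall>j\<in>{1..m}. AE x in ?D. \<pi> (x i) = \<pi> (x j)" by blast
    then show ?thesis by (simp add: AE_finite_all)
  qed
  then show "relative_joining X \<pi> m ?D"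
    unfolding relative_joining_def using inv by simp
qed

lemma relative_joining_over_reindex:
  assumes L: "relative_joining_over X (\<pi> ` X) \<pi> \<nu> n L" and \<sigma>: "\<sigma> \<in> {1..m} \<rightarrow> {1..n}" and m: "1 \<le> m"
  shows "relative_joining_over X (\<pi> ` X) \<pi> \<nu> m (distr L (borel_pow X m) (reindex m \<sigma>))"
proof -
  let ?D = "distr L (borel_pow X m) (reindex m \<sigma>)"
  note rj = relative_joining_overD(1)[OF L]
  have r: "reindex m \<sigma> \<in> measurable L (borel_pow X m)"
    by (rule measurable_reindex'[OF relative_joiningD(1)[OF rj] \<sigma>])
  have "distr ?D (borel_on (\<pi> ` X)) (\<lambda>x. \<pi> (x 1)) = \<nu>"
  proof -
    have "distr ?D (borel_on (\<pi> ` X)) (\<lambda>x. \<pi> (x 1)) = distr L (borel_on (\<pi> ` X)) ((\<lambda>x. \<pi> (x 1)) \<circ> reindex m \<sigma>)"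
      using m by (intro distr_distr r measurable_code_component) auto
    also have "\<dots> = distr L (borel_on (\<pi> ` X)) (\<lambda>x. \<pi> (x (\<sigma> 1)))"
      using m by (simp add: reindex_def comp_def)
    also have "\<dots> = \<nu>" by (rule relative_joining_over_image[OF L]) (use \<sigma> m in auto)
    finally show ?thesis .
  qed
  then show ?thesis
    by (rule relative_joining_over_intro[OF relative_joining_reindex[OF rj \<sigma>], rotated]) (use m in auto)
qed

lemma measurable_window:
  "(\<lambda>y. restrict y I) \<in> measurable (borel_on (\<pi> ` X)) (count_space (PiE I (\<lambda>_. UNIV :: 'b set)))"
  if "finite I" for I :: "int set"
proof -
  have "(\<lambda>y :: int \<Rightarrow> 'b. restrict y I) \<in> measurable borel (count_space (PiE I (\<lambda>_. UNIV)))"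
  proof (subst measurable_count_space_eq2)
    show "finite (PiE I (\<lambda>_. UNIV :: 'b set))" using that by (intro finite_PiE) auto
    have "(\<lambda>y. restrict y I) -` {w} \<inter> space borel \<in> sets borel" if w: "w \<in> PiE I (\<lambda>_. UNIV)" for w :: "int \<Rightarrow> 'b"
    proof -
      have "(\<lambda>y. restrict y I) -` {w} \<inter> space borel = {y. restrict y I = w}" by auto
      also have "\<dots> = (\<Inter>i\<in>I. {y. y i = w i})"
      proof (intro set_eqI iffI)
        fix y assume "y \<in> (\<Inter>i\<in>I. {y. y i = w i})"
        then have "restrict y I i = w i" for i using w by (cases "i \<in> I") (auto simp: PiE_def extensional_def)
        then show "y \<in> {y. restrict y I = w}" by auto
      qed auto
      also have "\<dots> \<in> sets borel"
        by (intro borel_open open_INT \<open>finite I\<close> ballI open_coord_eq)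
      finally show ?thesis .
    qed
    then show "(\<lambda>y. restrict y I) \<in> space borel \<rightarrow> PiE I (\<lambda>_. UNIV) \<and>
      (\<forall>w\<in>PiE I (\<lambda>_. UNIV :: 'b set). (\<lambda>y. restrict y I) -` {w} \<inter> space borel \<in> sets borel)" by auto
  qed
  then show ?thesis unfolding borel_on_def by (rule measurable_restrict_space1)
qed

text \<open>The coupling \<open>Q N\<close> matches the images of both points only on the coordinates \<open>- 2 N, \<dots>, 2 N\<close>. The
  averages \<open>f N\<close> of its shifts by \<open>0, \<dots>, N\<close> still match them on \<open>- N, \<dots>, N\<close>, they have the right
  marginals because \<open>L\<close> and \<open>L'\<close> are invariant, and a shift changes them by at most \<open>1 / (N + 1)\<close>.
  A cluster point of the \<open>f N\<close> thus has all the properties of a joining exactly.\<close>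

theorem relative_joining_exists:
  assumes L: "relative_joining_over X (\<pi> ` X) \<pi> \<nu> n L" and L': "relative_joining_over X (\<pi> ` X) \<pi> \<nu> n L'"
  obtains M where "relative_joining_over X (\<pi> ` X) \<pi> \<nu> (2 * n) M"
    "distr M (borel_pow X n) (reindex n (\<lambda>i. i)) = L"
    "distr M (borel_pow X n) (reindex n (\<lambda>i. n + i)) = L'"
proof -
  note n = relative_joining_overD(2)[OF L]
  note D = relative_joiningD[OF relative_joining_overD(1)[OF L]]
  note D' = relative_joiningD[OF relative_joining_overD(1)[OF L']]
  interpret L: prob_space L by (rule D(4))
  interpret L': prob_space L' by (rule D'(4))
  let ?\<Omega> = "PiE {1..2 * n} (\<lambda>_. X)" and ?B = "borel_pow X (2 * n)" and ?T = "shift_pow (2 * n)"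
  define r1 :: "(nat \<Rightarrow> int \<Rightarrow> 'a) \<Rightarrow> nat \<Rightarrow> int \<Rightarrow> 'a" where "r1 = reindex n (\<lambda>i. i)"
  define r2 :: "(nat \<Rightarrow> int \<Rightarrow> 'a) \<Rightarrow> nat \<Rightarrow> int \<Rightarrow> 'a" where "r2 = reindex n (\<lambda>i. n + i)"
  have \<sigma>: "(\<lambda>i. i) \<in> {1..n} \<rightarrow> {1..2 * n}" "(\<lambda>i. n + i) \<in> {1..n} \<rightarrow> {1..2 * n}" by auto
  have closed_\<Omega>: "closed ?\<Omega>" and compact_\<Omega>: "compact ?\<Omega>"
    using closed_pow_space[OF closed_X] compact_pow_space[OF closed_X] by blast+
  have sets_B: "sets ?B = sigma_sets ?\<Omega> (clopens ?\<Omega>)" by (rule sets_borel_pow_clopens[OF closed_X])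
  have clopen_B: "E \<in> sets ?B" if "E \<in> clopens ?\<Omega>" for E using that unfolding sets_B by blast
  \<comment> \<open>\<open>J\<close> writes the coordinates of two \<open>n\<close>-tuples one after the other.\<close>
  define J where "J z = (\<lambda>i\<in>{1..2 * n}. if i \<le> n then fst z i else snd z (i - n))"
    for z :: "(nat \<Rightarrow> int \<Rightarrow> 'a) \<times> (nat \<Rightarrow> int \<Rightarrow> 'a)"
  have J: "J \<in> measurable (L \<Otimes>\<^sub>M L') ?B"
    unfolding J_def[abs_def] borel_pow_def[of X "2 * n"]
  proof (rule measurable_restrict)
    fix i assume i: "i \<in> {1..2 * n}"
    show "(\<lambda>z. if i \<le> n then fst z i else snd z (i - n)) \<in> measurable (L \<Otimes>\<^sub>M L') (borel_on X)"
    proof (cases "i \<le> n")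
      case True
      then have "i \<in> {1..n}" using i by auto
      then have "(\<lambda>x. x i) \<in> measurable L (borel_on X)"
        using measurable_borel_pow_component[of i n X] measurable_cong_sets[OF D(1) refl] by blast
      from measurable_compose[OF measurable_fst this] show ?thesis using True by simp
    next
      case False
      then have "i - n \<in> {1..n}" using i by auto
      then have "(\<lambda>x. x (i - n)) \<in> measurable L' (borel_on X)"
        using measurable_borel_pow_component[of "i - n" n X] measurable_cong_sets[OF D'(1) refl] by blast
      from measurable_compose[OF measurable_snd this] show ?thesis using False by simp
    qed
  qed
  have r_J: "r1 (J z) = fst z" "r2 (J z) = snd z" if z: "z \<in> space (L \<Otimes>\<^sub>M L')" for z
  proof -
    have "fst z \<in> extensional {1..n}" "snd z \<in> extensional {1..n}"
      using z by (auto simp: space_pair_measure D(5) D'(5) PiE_def)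
    then show "r1 (J z) = fst z" "r2 (J z) = snd z"
      by (auto simp: r1_def r2_def reindex_def J_def fun_eq_iff extensional_def)
  qed
  define I where "I N = {- int (2 * N)..int (2 * N)}" for N
  define S where "S N = PiE (I N) (\<lambda>_. UNIV :: 'b set)" for N
  define W where "W N x = restrict (\<pi> (x 1)) (I N)" for N and x :: "nat \<Rightarrow> int \<Rightarrow> 'a"
  have finite_I: "finite (I N)" for N by (simp add: I_def)
  have finite_S: "finite (S N)" for N unfolding S_def by (intro finite_PiE finite_I) auto
  have one: "1 \<in> {1..n}" using n by simp
  have W: "W N \<in> measurable K (count_space (S N))"
    "distr K (count_space (S N)) (W N) = distr \<nu> (count_space (S N)) (\<lambda>y. restrict y (I N))"
    if K: "relative_joining_over X (\<pi> ` X) \<pi> \<nu> n K" for K N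
  proof -
    note c = measurable_code_component[OF relative_joiningD(1)[OF relative_joining_overD(1)[OF K]] one]
    show "W N \<in> measurable K (count_space (S N))"
      unfolding W_def[abs_def] S_def by (rule measurable_compose[OF c measurable_window[OF finite_I]])
    show "distr K (count_space (S N)) (W N) = distr \<nu> (count_space (S N)) (\<lambda>y. restrict y (I N))"
      using distr_distr[OF measurable_window[OF finite_I] c, of N] relative_joining_over_image[OF K one]
      by (simp add: comp_def W_def[abs_def] S_def)
  qed
  have "\<forall>N. \<exists>Q. prob_space Q \<and> sets Q = sets (L \<Otimes>\<^sub>M L') \<and> distr Q L fst = L \<and> distr Q L' snd = L' \<and>
      (AE z in Q. W N (fst z) = W N (snd z))"
  proof
    fix N
    have "distr L (count_space (S N)) (W N) = distr L' (count_space (S N)) (W N)"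
      by (simp only: W(2)[OF L] W(2)[OF L'])
    from coupling_over_finite_partition[OF D(4) D'(4) finite_S W(1)[OF L] W(1)[OF L'] this]
    show "\<exists>Q. prob_space Q \<and> sets Q = sets (L \<Otimes>\<^sub>M L') \<and> distr Q L fst = L \<and> distr Q L' snd = L' \<and>
      (AE z in Q. W N (fst z) = W N (snd z))" by blast
  qed
  from choice[OF this] obtain Q where Q_all: "\<forall>N. prob_space (Q N) \<and> sets (Q N) = sets (L \<Otimes>\<^sub>M L') \<and>
      distr (Q N) L fst = L \<and> distr (Q N) L' snd = L' \<and> (AE z in Q N. W N (fst z) = W N (snd z))" ..
  have Q: "prob_space (Q N)" "sets (Q N) = sets (L \<Otimes>\<^sub>M L')"
    "distr (Q N) L fst = L" "distr (Q N) L' snd = L'"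
    "AE z in Q N. W N (fst z) = W N (snd z)" for N
    using Q_all by simp_all
  have space_Q: "space (Q N) = space (L \<Otimes>\<^sub>M L')" for N using Q(2) by (rule sets_eq_imp_space_eq)
  have T: "?T \<in> measurable ?B ?B" by (rule measurable_shift_pow)
  have TJ: "(\<lambda>z. (?T ^^ k) (J z)) \<in> measurable (Q N) ?B" for k N
    using measurable_compose[OF J measurable_funpow[OF T, of k]] measurable_cong_sets[OF Q(2) refl] by blast
  have TJ_\<Omega>: "(?T ^^ k) (J z) \<in> ?\<Omega>" if "z \<in> space (Q N)" for k z N
    using measurable_space[OF TJ that] by simp
  \<comment> \<open>\<open>q N k E\<close> is the measure of \<open>E\<close> under the coupling \<open>Q N\<close> shifted by \<open>k\<close>.\<close>
  define q where "q N k E = measure (Q N) {z\<in>space (Q N). (?T ^^ k) (J z) \<in> E}" for N k E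
  have q01: "0 \<le> q N k E" "q N k E \<le> 1" for N k E
    unfolding q_def using prob_space.prob_le_1[OF Q(1)] by auto
  have q_sets: "{z\<in>space (Q N). (?T ^^ k) (J z) \<in> E} \<in> sets (Q N)" if "E \<in> clopens ?\<Omega>" for N k E
  proof -
    have "{z\<in>space (Q N). (?T ^^ k) (J z) \<in> E} = (\<lambda>z. (?T ^^ k) (J z)) -` E \<inter> space (Q N)" by blast
    then show ?thesis using measurable_sets[OF TJ clopen_B[OF that], of k N] by simp
  qed
  have q_add: "q N k (E \<union> F) = q N k E + q N k F"
    if "E \<in> clopens ?\<Omega>" "F \<in> clopens ?\<Omega>" "E \<inter> F = {}" for N k E F
  proof -
    interpret QN: prob_space "Q N" by (rule Q)
    have "{z\<in>space (Q N). (?T ^^ k) (J z) \<in> E \<union> F} =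
        {z\<in>space (Q N). (?T ^^ k) (J z) \<in> E} \<union> {z\<in>space (Q N). (?T ^^ k) (J z) \<in> F}" by blast
    then show ?thesis unfolding q_def
      using QN.finite_measure_Union[OF q_sets[OF that(1)] q_sets[OF that(2)]] that(3) by (auto simp: disjoint_iff)
  qed
  have q_\<Omega>: "q N k ?\<Omega> = 1" for N k
  proof -
    have "{z\<in>space (Q N). (?T ^^ k) (J z) \<in> ?\<Omega>} = space (Q N)" using TJ_\<Omega> by blast
    then show ?thesis unfolding q_def using prob_space.prob_space[OF Q(1)] by simp
  qed
  define f where "f N E = (\<Sum>k<Suc N. q N k E) / real (Suc N)" for N E
  have f_const: "f N E = a" if "\<And>k. k \<le> N \<Longrightarrow> q N k E = a" for N E a
  proof -
    have "(\<Sum>k<Suc N. q N k E) = (\<Sum>k<Suc N. a)" by (rule sum.cong) (use that in auto)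
    also have "\<dots> = real (Suc N) * a" by (simp only: sum_constant card_lessThan)
    finally show ?thesis unfolding f_def by (simp del: of_nat_Suc)
  qed
  have f01: "0 \<le> f N E \<and> f N E \<le> 1" for N E
  proof
    show "0 \<le> f N E" unfolding f_def by (intro divide_nonneg_nonneg sum_nonneg q01) simp
    have "(\<Sum>k<Suc N. q N k E) \<le> (\<Sum>k<Suc N. 1)" by (intro sum_mono q01)
    then show "f N E \<le> 1" unfolding f_def by simp
  qed
  have f_add: "f N (E \<union> F) = f N E + f N F"
    if "E \<in> clopens ?\<Omega>" "F \<in> clopens ?\<Omega>" "E \<inter> F = {}" for N E F
    unfolding f_def using q_add[OF that] by (simp only: sum.distrib add_divide_distrib)
  have f_\<Omega>: "f N ?\<Omega> = 1" for N by (rule f_const) (rule q_\<Omega>)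
  obtain M where M: "prob_space M" "sets M = sigma_sets ?\<Omega> (clopens ?\<Omega>)"
    "\<And>E F r. E \<in> clopens ?\<Omega> \<Longrightarrow> F \<in> clopens ?\<Omega> \<Longrightarrow> (\<lambda>n. f n E - f n F) \<longlonglongrightarrow> r \<Longrightarrow> measure M E - measure M F = r"
    using clopens_cluster_measure[OF compact_\<Omega> closed_\<Omega>, of f] f01 f_add f_\<Omega> by blast
  interpret M: prob_space M by (rule M)
  have sets_M: "sets M = sets ?B" by (simp only: M(2) sets_B)
  have space_M: "space M = ?\<Omega>" using sets_eq_imp_space_eq[OF sets_M] by simp
  have M_eqI: "measure M E = a" if E: "E \<in> clopens ?\<Omega>" and a: "eventually (\<lambda>N. f N E = a) sequentially" for E a
  proof -
    have "f N {} = 0" for N by (rule f_const) (simp add: q_def)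
    then have "eventually (\<lambda>N. f N E - f N {} = a) sequentially" using a by simp
    from M(3)[OF E clopens_empty[OF closed_\<Omega>] tendsto_eventually[OF this]] show ?thesis by simp
  qed
  have T_M: "?T \<in> measurable M M" using T measurable_cong_sets[OF sets_M sets_M] by blast
  have inv: "distr M M ?T = M"
  proof (rule measure_eqI_clopens[OF closed_\<Omega>])
    show "sets (distr M M ?T) = sigma_sets ?\<Omega> (clopens ?\<Omega>)" by (simp add: M(2))
    show "sets M = sigma_sets ?\<Omega> (clopens ?\<Omega>)" by (rule M(2))
    show "finite_measure (distr M M ?T)" by (rule M.finite_measure_distr[OF T_M])
    fix E assume E: "E \<in> clopens ?\<Omega>"
    define E' where "E' = ?T -` E \<inter> ?\<Omega>"
    have E': "E' \<in> clopens ?\<Omega>"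
      unfolding E'_def using shift_pow_PiE by (intro clopens_vimage[OF continuous_shift_pow closed_\<Omega> E]) auto
    have q_Suc: "q N k E' = q N (Suc k) E" for N k
      unfolding q_def E'_def using TJ_\<Omega>[of _ N k] by (auto intro!: arg_cong[where f = "measure (Q N)"])
    have "norm (f N E' - f N E) \<le> inverse (real (Suc N))" for N
    proof -
      have "f N E' - f N E = (\<Sum>k<Suc N. q N (Suc k) E - q N k E) / real (Suc N)"
        unfolding f_def q_Suc by (simp only: sum_subtractf diff_divide_distrib)
      also have "\<dots> = (q N (Suc N) E - q N 0 E) / real (Suc N)"
        using sum_lessThan_telescope[of "\<lambda>k. q N k E" "Suc N"] by (rule arg_cong)
      finally have "norm (f N E' - f N E) = \<bar>q N (Suc N) E - q N 0 E\<bar> / real (Suc N)"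
        by (simp only: real_norm_def abs_divide abs_of_nat)
      also have "\<dots> \<le> 1 / real (Suc N)"
        by (rule divide_right_mono) (use q01[of N "Suc N" E] q01[of N 0 E] in linarith, simp)
      finally show ?thesis by (simp only: inverse_eq_divide)
    qed
    then have "(\<lambda>N. f N E' - f N E) \<longlonglongrightarrow> 0"
      by (intro Lim_null_comparison[OF _ LIMSEQ_inverse_real_of_nat] always_eventually allI)
    from M(3)[OF E' E this] have "measure M E' = measure M E" by simp
    moreover have "emeasure (distr M M ?T) E = emeasure M E'"
      unfolding E'_def space_M[symmetric] using E by (intro emeasure_distr[OF T_M]) (simp add: M(2))
    ultimately show "emeasure (distr M M ?T) E = emeasure M E" by (simp add: M.emeasure_eq_measure)
  qed
  have marginal: "distr M (borel_pow X n) (reindex n s) = K"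
    if s: "s \<in> {1..n} \<rightarrow> {1..2 * n}" and K: "relative_joining_over X (\<pi> ` X) \<pi> \<nu> n K"
      and p: "\<And>N. p \<in> measurable (Q N) K" "\<And>N. distr (Q N) K p = K"
      and pJ: "\<And>z. z \<in> space (L \<Otimes>\<^sub>M L') \<Longrightarrow> reindex n s (J z) = p z" for s p K
  proof (rule measure_eqI_clopens[OF closed_pow_space[OF closed_X]])
    let ?C = "clopens (PiE {1..n} (\<lambda>_. X))"
    note DK = relative_joiningD[OF relative_joining_overD(1)[OF K]]
    interpret K: prob_space K by (rule DK(4))
    have s_M: "reindex n s \<in> measurable M (borel_pow X n)"
      using measurable_reindex[OF s, of X] measurable_cong_sets[OF sets_M refl] by blast
    show "sets (distr M (borel_pow X n) (reindex n s)) = sigma_sets (PiE {1..n} (\<lambda>_. X)) ?C"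
      "sets K = sigma_sets (PiE {1..n} (\<lambda>_. X)) ?C"
      by (simp_all only: sets_distr DK(1) sets_borel_pow_clopens[OF closed_X])
    show "finite_measure (distr M (borel_pow X n) (reindex n s))" by (rule M.finite_measure_distr[OF s_M])
    fix A assume A: "A \<in> ?C"
    then have A_sets: "A \<in> sets (borel_pow X n)" unfolding sets_borel_pow_clopens[OF closed_X] by blast
    define E where "E = reindex n s -` A \<inter> ?\<Omega>"
    have E: "E \<in> clopens ?\<Omega>"
      unfolding E_def using reindex_PiE[OF s] by (intro clopens_vimage[OF continuous_reindex closed_\<Omega> A]) auto
    have "q N k E = measure K A" for N k
    proof -
      have "{z\<in>space (Q N). (?T ^^ k) (J z) \<in> E} = p -` ((shift_pow n ^^ k) -` A \<inter> space K) \<inter> space (Q N)"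
        using TJ_\<Omega>[of _ N k] measurable_space[OF p(1), of _ N] pJ
        by (auto simp: E_def reindex_shift_pow_funpow[OF s] space_Q)
      then have "q N k E = measure (Q N) (p -` ((shift_pow n ^^ k) -` A \<inter> space K) \<inter> space (Q N))"
        by (simp add: q_def)
      also have "\<dots> = measure (distr (Q N) K p) ((shift_pow n ^^ k) -` A \<inter> space K)"
        by (intro measure_distr[symmetric] p measurable_sets[OF invariant_measureD(2)[OF invariant_measure_funpow[OF DK(2)]]])
          (simp add: A_sets DK(1))
      also have "\<dots> = measure K A"
        unfolding p(2) measure_def
        using invariant_emeasure_vimage[OF invariant_measure_funpow[OF DK(2)], of A k] A_sets DK(1) by simp
      finally show ?thesis .
    qed
    then have "measure M E = measure K A" by (intro M_eqI[OF E] always_eventually allI f_const)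
    moreover have "emeasure (distr M (borel_pow X n) (reindex n s)) A = emeasure M E"
      unfolding E_def space_M[symmetric] by (rule emeasure_distr[OF s_M A_sets])
    ultimately show "emeasure (distr M (borel_pow X n) (reindex n s)) A = emeasure K A"
      by (simp add: M.emeasure_eq_measure K.emeasure_eq_measure)
  qed
  have fst_Q: "fst \<in> measurable (Q N) L" and snd_Q: "snd \<in> measurable (Q N) L'" for N
    using measurable_cong_sets[OF Q(2) refl] measurable_fst measurable_snd by blast+
  have m1: "distr M (borel_pow X n) r1 = L"
    unfolding r1_def by (rule marginal[OF \<sigma>(1) L fst_Q Q(3)]) (use r_J in \<open>simp add: r1_def\<close>)
  have m2: "distr M (borel_pow X n) r2 = L'"
    unfolding r2_def by (rule marginal[OF \<sigma>(2) L' snd_Q Q(4)]) (use r_J in \<open>simp add: r2_def\<close>)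
  \<comment> \<open>Agreement of the images at one coordinate is a clopen condition, of full measure for large \<open>N\<close>.\<close>
  have agree: "AE x in M. \<pi> (x 1) = \<pi> (x (n + 1))"
  proof -
    have in_\<Omega>: "1 \<in> {1..2 * n}" "n + 1 \<in> {1..2 * n}" using n by auto
    have "AE x in M. \<pi> (x 1) j = \<pi> (x (n + 1)) j" for j
    proof -
      define E where "E = {x\<in>?\<Omega>. \<pi> (x 1) j = \<pi> (x (n + 1)) j}"
      have cl: "closed {x\<in>?\<Omega>. \<pi> (x 1) j = a \<and> \<pi> (x (n + 1)) j = b}" for a b
      proof -
        have "{x\<in>?\<Omega>. \<pi> (x 1) j = a \<and> \<pi> (x (n + 1)) j = b} =
          ?\<Omega> \<inter> (\<lambda>x. x 1) -` {x\<in>X. \<pi> x j = a} \<inter> (\<lambda>x. x (n + 1)) -` {x\<in>X. \<pi> x j = b}"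
          using in_\<Omega> by (auto simp: PiE_def Pi_def)
        then show ?thesis
          by (simp only: closed_Int closed_\<Omega> closed_vimage[OF closed_code_eq continuous_on_product_coordinates])
      qed
      have E: "E \<in> clopens ?\<Omega>"
      proof (rule clopensI)
        have "E = (\<Union>a. {x\<in>?\<Omega>. \<pi> (x 1) j = a \<and> \<pi> (x (n + 1)) j = a})" by (auto simp: E_def)
        also have "closed \<dots>" by (intro closed_UN cl ballI) simp
        finally show "closed E" .
        have "?\<Omega> - E = (\<Union>a. \<Union>b\<in>- {a}. {x\<in>?\<Omega>. \<pi> (x 1) j = a \<and> \<pi> (x (n + 1)) j = b})" by (auto simp: E_def)
        also have "closed \<dots>" by (intro closed_UN cl ballI) simp_all
        finally show "closed (?\<Omega> - E)" .
      qed (simp add: E_def)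
      have "f N E = 1" if N: "nat \<bar>j\<bar> \<le> N" for N
      proof (rule f_const)
        fix k assume k: "k \<le> N"
        interpret QN: prob_space "Q N" by (rule Q)
        have "AE z in Q N. z \<in> {z\<in>space (Q N). (?T ^^ k) (J z) \<in> E}"
          using Q(5)[of N] AE_space
        proof eventually_elim
          case (elim z)
          then have "fst z 1 \<in> X" "snd z 1 \<in> X"
            using one by (auto simp: space_Q space_pair_measure D(5) D'(5) PiE_def Pi_def)
          moreover have "\<pi> (fst z 1) (j + int k) = \<pi> (snd z 1) (j + int k)"
          proof -
            have "j + int k \<in> I N" using N k by (auto simp: I_def)
            then show ?thesis using elim(1) unfolding W_def by (metis restrict_apply')
          qed
          moreover have "J z 1 = fst z 1" "J z (n + 1) = snd z 1" using n by (auto simp: J_def)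
          ultimately have "\<pi> ((?T ^^ k) (J z) 1) j = \<pi> ((?T ^^ k) (J z) (n + 1)) j"
            unfolding shift_pow_funpow_apply[OF in_\<Omega>(1)] shift_pow_funpow_apply[OF in_\<Omega>(2)]
            by (simp only: code_shift_funpow shift_funpow_apply)
          then show ?case using elim(2) TJ_\<Omega>[of z N k] by (simp add: E_def)
        qed
        then show "q N k E = 1" unfolding q_def by (subst (asm) QN.AE_in_set_eq_1[OF q_sets[OF E]])
      qed
      then have "measure M E = 1"
        by (intro M_eqI[OF E]) (auto simp: eventually_sequentially)
      moreover have "E \<in> sets M" using clopen_B[OF E] sets_M by simp
      ultimately have "AE x in M. x \<in> E" by (simp add: M.AE_in_set_eq_1)
      then show ?thesis by eventually_elim (simp add: E_def)
    qed
    then have "AE x in M. \<forall>j. \<pi> (x 1) j = \<pi> (x (n + 1)) j" by (simp add: AE_all_countable)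
    then show ?thesis by eventually_elim auto
  qed
  have r_M: "r1 \<in> measurable M (borel_pow X n)" "r2 \<in> measurable M (borel_pow X n)"
    unfolding r1_def r2_def
    using measurable_reindex[OF \<sigma>(1), of X] measurable_reindex[OF \<sigma>(2), of X] measurable_cong_sets[OF sets_M refl] by blast+
  have "AE x in distr M (borel_pow X n) r1. \<forall>i\<in>{1..n}. \<forall>j\<in>{1..n}. \<pi> (x i) = \<pi> (x j)"
    unfolding m1 by (rule D(3))
  from AE_distrD[OF r_M(1) this]
  have a1: "AE x in M. \<forall>i\<in>{1..n}. \<forall>j\<in>{1..n}. \<pi> (x i) = \<pi> (x j)"
  proof (eventually_elim, intro ballI)
    fix x i j
    assume eq: "\<forall>i\<in>{1..n}. \<forall>j\<in>{1..n}. \<pi> (r1 x i) = \<pi> (r1 x j)" and ij: "i \<in> {1..n}" "j \<in> {1..n}"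
    have "r1 x i = x i" "r1 x j = x j" using ij by (simp_all add: r1_def reindex_def)
    then show "\<pi> (x i) = \<pi> (x j)" using bspec[OF bspec[OF eq ij(1)] ij(2)] by (simp only:)
  qed
  have "AE x in distr M (borel_pow X n) r2. \<forall>i\<in>{1..n}. \<forall>j\<in>{1..n}. \<pi> (x i) = \<pi> (x j)"
    unfolding m2 by (rule D'(3))
  from AE_distrD[OF r_M(2) this]
  have a2: "AE x in M. \<forall>i\<in>{1..n}. \<forall>j\<in>{1..n}. \<pi> (x (n + i)) = \<pi> (x (n + j))"
  proof (eventually_elim, intro ballI)
    fix x i j
    assume eq: "\<forall>i\<in>{1..n}. \<forall>j\<in>{1..n}. \<pi> (r2 x i) = \<pi> (r2 x j)" and ij: "i \<in> {1..n}" "j \<in> {1..n}"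
    have "r2 x i = x (n + i)" "r2 x j = x (n + j)" using ij by (simp_all add: r2_def reindex_def)
    then show "\<pi> (x (n + i)) = \<pi> (x (n + j))" using bspec[OF bspec[OF eq ij(1)] ij(2)] by (simp only:)
  qed
  have "AE x in M. \<forall>i\<in>{1..2 * n}. \<forall>j\<in>{1..2 * n}. \<pi> (x i) = \<pi> (x j)"
    using agree a1 a2
  proof eventually_elim
    case (elim x)
    have eq: "\<pi> (x i) = \<pi> (x 1)" if i: "i \<in> {1..2 * n}" for i
    proof (cases "i \<le> n")
      case True
      then have "i \<in> {1..n}" using i by simp
      from bspec[OF bspec[OF elim(2) this] one] show ?thesis .
    next
      case False
      then have "i - n \<in> {1..n}" "i = n + (i - n)" using i by auto
      then have "\<pi> (x i) = \<pi> (x (n + 1))" using elim(3) one by metis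
      from this elim(1)[symmetric] show ?thesis by (rule trans)
    qed
    show ?case by (intro ballI, rule trans[OF eq eq[symmetric]], assumption+)
  qed
  then have rj: "relative_joining X \<pi> (2 * n) M"
    unfolding relative_joining_def invariant_measure_def using sets_M T_M inv M.prob_space_axioms by blast
  have "distr M (borel_on (\<pi> ` X)) (\<lambda>x. \<pi> (x 1)) = \<nu>"
  proof -
    have "distr L (borel_on (\<pi> ` X)) (\<lambda>x. \<pi> (x 1)) = distr M (borel_on (\<pi> ` X)) ((\<lambda>x. \<pi> (x 1)) \<circ> r1)"
      unfolding m1[symmetric] by (rule distr_distr[OF measurable_code_component[OF refl one] r_M(1)])
    also have "(\<lambda>x. \<pi> (x 1)) \<circ> r1 = (\<lambda>x. \<pi> (x 1))" using n by (auto simp: r1_def reindex_def)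
    finally show ?thesis using relative_joining_over_image[OF L one] by simp
  qed
  then have "relative_joining_over X (\<pi> ` X) \<pi> \<nu> (2 * n) M"
    by (rule relative_joining_over_intro[OF rj, rotated]) (use n in auto)
  then show thesis using that m1 m2 unfolding r1_def r2_def by blast
qed

section \<open>Matching the classes of two class degree joinings\<close>

lemma sets_trans_rel_Collect:
  assumes "finite I" "a \<in> I \<rightarrow> {1..m}" "b \<in> I \<rightarrow> {1..m}"
  shows "{x\<in>space (borel_pow X m). \<forall>i\<in>I. (x (a i), x (b i)) \<in> trans_rel X \<pi>} \<in> sets (borel_pow X m)"
proof (rule sets.sets_Collect_finite_All[OF _ assms(1)])
  fix i assume "i \<in> I"
  then have ab: "a i \<in> {1..m}" "b i \<in> {1..m}" using assms by auto
  have "(\<lambda>x. (x (a i), x (b i))) \<in> borel_measurable (borel_pow X m)"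
    by (rule borel_measurable_Pair[OF measurable_borel_on_borel[OF measurable_borel_pow_component[OF ab(1)]]
        measurable_borel_on_borel[OF measurable_borel_pow_component[OF ab(2)]]])
  from measurable_sets[OF this trans_rel_borel]
  show "{x\<in>space (borel_pow X m). (x (a i), x (b i)) \<in> trans_rel X \<pi>} \<in> sets (borel_pow X m)"
    by (simp add: vimage_def Int_def conj_commute)
qed

text \<open>Two families of \<open>c\<close> points in distinct classes both exhaust the \<open>c\<close> classes, so each point of
  the second family has a unique partner in the first.\<close>

lemma matching_permutation:
  assumes C: "finite (transition_classes X \<pi> y)" "card (transition_classes X \<pi> y) = c"
    and x: "\<And>i. i \<in> {1..c} \<Longrightarrow> x i \<in> X \<and> \<pi> (x i) = y" and x': "\<And>i. i \<in> {1..c} \<Longrightarrow> x' i \<in> X \<and> \<pi> (x' i) = y"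
    and inj: "inj_on (\<lambda>i. trans_rel X \<pi> `` {x i}) {1..c}" and inj': "inj_on (\<lambda>i. trans_rel X \<pi> `` {x' i}) {1..c}"
  obtains f where "f permutes {1..c}" "\<And>i. i \<in> {1..c} \<Longrightarrow> (x (f i), x' i) \<in> trans_rel X \<pi>"
proof -
  let ?cl = "\<lambda>z. trans_rel X \<pi> `` {z}"
  have mem: "?cl z \<in> transition_classes X \<pi> y" if "z \<in> X \<and> \<pi> z = y" for z
    using that by (auto simp: transition_classes_def quotient_def)
  have "(\<lambda>i. ?cl (x i)) ` {1..c} = transition_classes X \<pi> y"
  proof (rule card_subset_eq[OF C(1)])
    show "(\<lambda>i. ?cl (x i)) ` {1..c} \<subseteq> transition_classes X \<pi> y"
      using mem x by blast
    show "card ((\<lambda>i. ?cl (x i)) ` {1..c}) = card (transition_classes X \<pi> y)"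
      using card_image[OF inj] C(2) by simp
  qed
  then have "\<forall>i\<in>{1..c}. \<exists>k\<in>{1..c}. ?cl (x k) = ?cl (x' i)"
    using mem x' by (metis (no_types, lifting) imageE)
  then obtain g where g: "\<And>i. i \<in> {1..c} \<Longrightarrow> g i \<in> {1..c} \<and> ?cl (x (g i)) = ?cl (x' i)" by metis
  define f where "f i = (if i \<in> {1..c} then g i else i)" for i
  have "inj_on f {1..c}"
  proof (rule inj_onI)
    fix i j assume ij: "i \<in> {1..c}" "j \<in> {1..c}" "f i = f j"
    then have "?cl (x' i) = ?cl (x' j)" using g by (metis f_def)
    then show "i = j" using inj_onD[OF inj'] ij by blast
  qed
  moreover have "f ` {1..c} \<subseteq> {1..c}" using g by (auto simp: f_def)
  ultimately have "bij_betw f {1..c} {1..c}"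
    by (simp add: bij_betw_def endo_inj_surj)
  then have "f permutes {1..c}" by (rule bij_imp_permutes) (auto simp: f_def)
  moreover have "(x (f i), x' i) \<in> trans_rel X \<pi>" if "i \<in> {1..c}" for i
    using eq_equiv_class[OF _ equiv_trans_rel, of "x (f i)" "x' i"] g[OF that] x'[OF that] that by (simp add: f_def)
  ultimately show thesis by (rule that)
qed

theorem relative_joining_uniform_measure:
  assumes M: "relative_joining X \<pi> m M" and A: "A \<in> sets M" "emeasure M A \<noteq> 0"
    and inv: "shift_pow m -` A \<inter> space M = A"
  shows "relative_joining X \<pi> m (uniform_measure M A)"
proof -
  note D = relative_joiningD[OF M]
  interpret prob_space M by (rule D(4))
  let ?N = "uniform_measure M A" and ?T = "shift_pow m"
  note T = invariant_measureD[OF D(2)]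
  have "prob_space ?N" by (rule prob_space_uniform_measure[OF A(2)]) simp
  moreover have TN: "?T \<in> measurable ?N ?N" using T(2) by simp
  moreover have "distr ?N ?N ?T = ?N"
  proof (rule measure_eqI)
    fix B assume "B \<in> sets (distr ?N ?N ?T)"
    then have B: "B \<in> sets M" by simp
    have "A \<inter> (?T -` B \<inter> space M) = ?T -` (A \<inter> B) \<inter> space M" using inv by blast
    then have "emeasure M (A \<inter> (?T -` B \<inter> space M)) = emeasure M (A \<inter> B)"
      using invariant_emeasure_vimage[OF D(2), of "A \<inter> B"] A(1) B by simp
    then show "emeasure (distr ?N ?N ?T) B = emeasure ?N B"
      using B A(1) measurable_sets[OF T(2) B] TN by (simp add: emeasure_distr)
  qed simp
  moreover have "AE x in ?N. \<forall>i\<in>{1..m}. \<forall>j\<in>{1..m}. \<pi> (x i) = \<pi> (x j)"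
    using D(3) A(2) by (intro AE_uniform_measureI[OF A(1)]) auto
  ultimately show ?thesis
    unfolding relative_joining_def invariant_measure_def using D(1) by simp
qed

text \<open>Conditioning on \<open>A f\<close> for a permutation \<open>f\<close> with \<open>A f\<close> of positive measure gives a measure \<open>N\<close> that
  still couples \<open>L\<close> and \<open>L'\<close>, by extremality of ergodic measures; reindexing its first \<open>c\<close>
  coordinates by \<open>f\<close> turns the matching into the identity.\<close>

theorem class_degree_joinings_parallel:
  assumes \<nu>: "ergodic_measure_on (\<pi> ` X) \<nu>" and c: "c = class_degree X \<pi> \<nu>"
    and L: "class_degree_joining X (\<pi> ` X) \<pi> \<nu> L" and L': "class_degree_joining X (\<pi> ` X) \<pi> \<nu> L'"
  shows "\<exists>f. f permutes {1..c} \<and>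
    class_parallel X (\<pi> ` X) \<pi> \<nu> c (distr L (borel_pow X c) (permute_coords c f)) L'"
proof -
  have LD: "relative_joining_over X (\<pi> ` X) \<pi> \<nu> c L" "class_separating X \<pi> c L" "ergodic_measure L (shift_pow c)"
    and LD': "relative_joining_over X (\<pi> ` X) \<pi> \<nu> c L'" "class_separating X \<pi> c L'" "ergodic_measure L' (shift_pow c)"
    using L L' by (auto simp: class_degree_joining_def c)
  have c1: "1 \<le> c" by (rule relative_joining_overD(2)[OF LD(1)])
  let ?s1 = "\<lambda>i::nat. i" and ?s2 = "\<lambda>i. c + i"
  have one: "1 \<in> {1..2 * c}" using c1 by simp
  have s: "?s1 \<in> {1..c} \<rightarrow> {1..2 * c}" "?s2 \<in> {1..c} \<rightarrow> {1..2 * c}" by auto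
  obtain M where M: "relative_joining_over X (\<pi> ` X) \<pi> \<nu> (2 * c) M"
    and M1: "distr M (borel_pow X c) (reindex c ?s1) = L"
    and M2: "distr M (borel_pow X c) (reindex c ?s2) = L'"
    using relative_joining_exists[OF LD(1) LD'(1)] by blast
  note MJ = relative_joining_overD(1)[OF M]
  note D = relative_joiningD[OF MJ]
  interpret M: prob_space M by (rule D(4))
  have r1: "reindex c ?s1 \<in> measurable M (borel_pow X c)" and r2: "reindex c ?s2 \<in> measurable M (borel_pow X c)"
    by (rule measurable_reindex'[OF D(1)], simp add: s)+
  define A where "A f = {x\<in>space M. \<forall>i\<in>{1..c}. (x (f i), x (c + i)) \<in> trans_rel X \<pi>}" for f
  have perm_in: "f \<in> {1..c} \<rightarrow> {1..2 * c}" if "f permutes {1..c}" for f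
    using permutes_in_image[OF that] by fastforce
  have A_sets: "A f \<in> sets M" if "f permutes {1..c}" for f
    using sets_trans_rel_Collect[OF finite_atLeastAtMost perm_in[OF that] s(2)]
    unfolding A_def D(1) D(5) space_borel_pow .
  have cover: "AE x in M. \<exists>f\<in>{f. f permutes {1..c}}. x \<in> A f"
  proof -
    have im: "distr M (borel_on (\<pi> ` X)) (\<lambda>x. \<pi> (x 1)) = \<nu>"
      by (rule relative_joining_over_image[OF M one])
    have "AE y in distr M (borel_on (\<pi> ` X)) (\<lambda>x. \<pi> (x 1)).
        finite (transition_classes X \<pi> y) \<and> card (transition_classes X \<pi> y) = c"
      unfolding im c by (rule AE_card_transition_classes[OF \<nu>])
    from AE_distrD[OF measurable_code_component[OF D(1) one] this]
    have 1: "AE x in M. finite (transition_classes X \<pi> (\<pi> (x 1))) \<and> card (transition_classes X \<pi> (\<pi> (x 1))) = c" .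
    have "AE x in distr M (borel_pow X c) (reindex c ?s1). inj_on (\<lambda>i. trans_rel X \<pi> `` {x i}) {1..c}"
      unfolding M1 using LD(2) by (simp add: class_separating_def)
    from AE_distrD[OF r1 this]
    have 2: "AE x in M. inj_on (\<lambda>i. trans_rel X \<pi> `` {x i}) {1..c}"
    proof eventually_elim
      case (elim x)
      have "inj_on (\<lambda>i. trans_rel X \<pi> `` {reindex c ?s1 x i}) {1..c} = inj_on (\<lambda>i. trans_rel X \<pi> `` {x i}) {1..c}"
        by (rule inj_on_cong) (simp add: reindex_def)
      then show ?case using elim by (rule iffD1)
    qed
    have "AE x in distr M (borel_pow X c) (reindex c ?s2). inj_on (\<lambda>i. trans_rel X \<pi> `` {x i}) {1..c}"
      unfolding M2 using LD'(2) by (simp add: class_separating_def)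
    from AE_distrD[OF r2 this]
    have 3: "AE x in M. inj_on (\<lambda>i. trans_rel X \<pi> `` {x (c + i)}) {1..c}"
    proof eventually_elim
      case (elim x)
      have "inj_on (\<lambda>i. trans_rel X \<pi> `` {reindex c ?s2 x i}) {1..c} = inj_on (\<lambda>i. trans_rel X \<pi> `` {x (c + i)}) {1..c}"
        by (rule inj_on_cong) (simp add: reindex_def)
      then show ?case using elim by (rule iffD1)
    qed
    show ?thesis using 1 2 3 D(3) AE_space
    proof eventually_elim
      case (elim x)
      have in_X: "x i \<in> X \<and> \<pi> (x i) = \<pi> (x 1)" if "i \<in> {1..2 * c}" for i
      proof
        show "x i \<in> X" using elim(5) that unfolding D(5) by (rule PiE_mem)
        show "\<pi> (x i) = \<pi> (x 1)" by (rule bspec[OF bspec[OF elim(4) that] one])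
      qed
      obtain f where f: "f permutes {1..c}" "\<And>i. i \<in> {1..c} \<Longrightarrow> (x (f i), x (c + i)) \<in> trans_rel X \<pi>"
      proof (rule matching_permutation[of "\<pi> (x 1)" c x "\<lambda>i. x (c + i)"])
        show "x i \<in> X \<and> \<pi> (x i) = \<pi> (x 1)" if "i \<in> {1..c}" for i using in_X[of i] that by auto
        show "x (c + i) \<in> X \<and> \<pi> (x (c + i)) = \<pi> (x 1)" if "i \<in> {1..c}" for i using in_X[of "c + i"] that by auto
      qed (use elim(1,2,3) in \<open>blast+\<close>)
      then have "x \<in> A f" using elim(5) by (simp add: A_def)
      then show ?case using f(1) by blast
    qed
  qed
  have "\<exists>f. f permutes {1..c} \<and> \<not> (AE x in M. x \<notin> A f)"
  proof (rule ccontr)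
    assume neg: "\<not> ?thesis"
    have "AE x in M. \<forall>f\<in>{f. f permutes {1..c}}. x \<notin> A f"
      by (rule AE_finite_allI[OF finite_permutations[OF finite_atLeastAtMost]]) (use neg in blast)
    with cover have "AE x in M. False" by eventually_elim blast
    then show False by simp
  qed
  then obtain f where f: "f permutes {1..c}" and "\<not> (AE x in M. x \<notin> A f)" by blast
  then have pos: "emeasure M (A f) \<noteq> 0"
    using A_sets[OF f] AE_not_in[of "A f" M] by (auto simp: null_sets_def)
  have fc: "f i \<in> {1..2 * c}" "c + i \<in> {1..2 * c}" if "i \<in> {1..c}" for i
    using perm_in[OF f] that by auto
  have A_inv: "shift_pow (2 * c) -` A f \<inter> space M = A f"
  proof -
    have "shift_pow (2 * c) x \<in> A f \<longleftrightarrow> x \<in> A f" if x: "x \<in> space M" for x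
    proof -
      have "shift_pow (2 * c) x \<in> space M"
        using x shift_pow_PiE unfolding D(5) by blast
      then show ?thesis
        using x fc by (simp add: A_def shift_pow_def trans_rel_shift_iff)
    qed
    then show ?thesis by (auto simp: A_def)
  qed
  define N where "N = uniform_measure M (A f)"
  have NJ: "relative_joining X \<pi> (2 * c) N"
    unfolding N_def by (rule relative_joining_uniform_measure[OF MJ A_sets[OF f] pos A_inv])
  note ND = relative_joiningD[OF NJ]
  interpret N: prob_space N by (rule ND(4))
  \<comment> \<open>The marginals of \<open>N\<close> are invariant and dominated by those of \<open>M\<close>, which are ergodic.\<close>
  have marginal: "distr N (borel_pow X c) (reindex c t) = K"
    if K: "ergodic_measure K (shift_pow c)" and t: "t \<in> {1..c} \<rightarrow> {1..2 * c}"
      and MK: "distr M (borel_pow X c) (reindex c t) = K" for K t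
  proof (rule ergodic_measure_extremal[OF K])
    have rt: "reindex c t \<in> measurable M (borel_pow X c)" "reindex c t \<in> measurable N (borel_pow X c)"
      by (rule measurable_reindex'[OF D(1) t], rule measurable_reindex'[OF ND(1) t])
    show "invariant_measure (distr N (borel_pow X c) (reindex c t)) (shift_pow c)"
      by (rule relative_joiningD(2)[OF relative_joining_reindex[OF NJ t]])
    show "sets (distr N (borel_pow X c) (reindex c t)) = sets K" by (simp flip: MK)
    show "absolutely_continuous K (distr N (borel_pow X c) (reindex c t))"
      unfolding absolutely_continuous_def
    proof
      fix B assume "B \<in> null_sets K"
      then have B: "B \<in> sets (borel_pow X c)" "emeasure M (reindex c t -` B \<inter> space M) = 0"
        using emeasure_distr[OF rt(1), of B] by (auto simp: null_sets_def simp flip: MK)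
      have P: "reindex c t -` B \<inter> space M \<in> sets M" by (rule measurable_sets[OF rt(1) B(1)])
      have "emeasure M (A f \<inter> (reindex c t -` B \<inter> space M)) \<le> 0"
        unfolding B(2)[symmetric] by (rule emeasure_mono[OF Int_lower2 P])
      then have "emeasure N (reindex c t -` B \<inter> space M) = 0"
        unfolding N_def using A_sets[OF f] P by simp
      then show "B \<in> null_sets (distr N (borel_pow X c) (reindex c t))"
        using B(1) emeasure_distr[OF rt(2) B(1)] by (simp add: null_sets_def N_def)
    qed
  qed
  have N1: "distr N (borel_pow X c) (reindex c ?s1) = L" by (rule marginal[OF LD(3) s(1) M1])
  have N2: "distr N (borel_pow X c) (reindex c ?s2) = L'" by (rule marginal[OF LD'(3) s(2) M2])
  have rN: "reindex c t \<in> measurable N (borel_pow X c)" if "t \<in> {1..c} \<rightarrow> {1..2 * c}" for t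
    by (rule measurable_reindex'[OF ND(1) that])
  have N_over: "relative_joining_over X (\<pi> ` X) \<pi> \<nu> (2 * c) N"
  proof (rule relative_joining_over_intro[OF NJ, of 1])
    have "\<nu> = distr L (borel_on (\<pi> ` X)) (\<lambda>x. \<pi> (x 1))"
      by (rule relative_joining_over_image[OF LD(1), symmetric]) (use c1 in simp)
    also have "\<dots> = distr N (borel_on (\<pi> ` X)) ((\<lambda>x. \<pi> (x 1)) \<circ> reindex c ?s1)"
      unfolding N1[symmetric] by (rule distr_distr[OF measurable_code_component[OF refl] rN[OF s(1)]]) (use c1 in simp)
    also have "(\<lambda>x. \<pi> (x 1)) \<circ> reindex c ?s1 = (\<lambda>x. \<pi> (x 1))" using c1 by (auto simp: reindex_def)
    finally show "distr N (borel_on (\<pi> ` X)) (\<lambda>x. \<pi> (x 1)) = \<nu>" by simp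
  qed (use c1 in simp)
  define g where "g i = (if i \<le> c then f i else i)" for i
  have g: "g \<in> {1..2 * c} \<rightarrow> {1..2 * c}" using fc by (auto simp: g_def)
  have rg: "reindex (2 * c) g \<in> measurable N (borel_pow X (2 * c))"
    by (rule measurable_reindex'[OF ND(1) g])
  define L'' where "L'' = distr N (borel_pow X (2 * c)) (reindex (2 * c) g)"
  have over: "relative_joining_over X (\<pi> ` X) \<pi> \<nu> (2 * c) L''"
    unfolding L''_def by (rule relative_joining_over_reindex[OF N_over g]) (use c1 in simp)
  have f_self: "f \<in> {1..c} \<rightarrow> {1..c}" using permutes_in_image[OF f] by fastforce
  have perm_eq: "permute_coords c f = reindex c f" by (simp add: permute_coords_def reindex_def fun_eq_iff)
  have over1: "relative_joining_over X (\<pi> ` X) \<pi> \<nu> c (distr L (borel_pow X c) (permute_coords c f))"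
    unfolding perm_eq by (rule relative_joining_over_reindex[OF LD(1) f_self c1])
  have first: "distr L'' (borel_pow X c) (reindex c ?s1) = distr L (borel_pow X c) (permute_coords c f)"
  proof -
    have swap: "reindex c ?s1 \<circ> reindex (2 * c) g = reindex c f \<circ> reindex c ?s1"
      using f_self by (auto simp: fun_eq_iff reindex_def g_def Pi_def)
    have "distr L'' (borel_pow X c) (reindex c ?s1) = distr N (borel_pow X c) (reindex c ?s1 \<circ> reindex (2 * c) g)"
      unfolding L''_def by (rule distr_distr[OF measurable_reindex[OF s(1)] rg])
    also have "\<dots> = distr (distr N (borel_pow X c) (reindex c ?s1)) (borel_pow X c) (reindex c f)"
      unfolding swap by (rule distr_distr[symmetric, OF measurable_reindex[OF f_self] rN[OF s(1)]])
    finally show ?thesis by (simp only: N1 perm_eq)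
  qed
  have second: "distr L'' (borel_pow X c) (reindex c ?s2) = L'"
  proof -
    have swap: "reindex c ?s2 \<circ> reindex (2 * c) g = reindex c ?s2"
      by (auto simp: fun_eq_iff reindex_def g_def)
    have "distr L'' (borel_pow X c) (reindex c ?s2) = distr N (borel_pow X c) (reindex c ?s2 \<circ> reindex (2 * c) g)"
      unfolding L''_def by (rule distr_distr[OF measurable_reindex[OF s(2)] rg])
    then show ?thesis by (simp only: swap N2)
  qed
  have par: "AE x in L''. \<forall>i\<in>{1..c}. (x i, x (c + i)) \<in> trans_rel X \<pi>"
    unfolding L''_def
  proof (subst AE_distr_iff[OF rg])
    show "{x\<in>space (borel_pow X (2 * c)). \<forall>i\<in>{1..c}. (x i, x (c + i)) \<in> trans_rel X \<pi>} \<in> sets (borel_pow X (2 * c))"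
      by (rule sets_trans_rel_Collect[OF finite_atLeastAtMost s])
    have "AE x in N. x \<in> A f"
      unfolding N_def using A_sets[OF f] by (intro AE_uniform_measureI) auto
    then show "AE x in N. \<forall>i\<in>{1..c}. (reindex (2 * c) g x i, reindex (2 * c) g x (c + i)) \<in> trans_rel X \<pi>"
      by eventually_elim (use fc in \<open>auto simp: A_def reindex_def g_def\<close>)
  qed
  have "class_parallel X (\<pi> ` X) \<pi> \<nu> c (distr L (borel_pow X c) (permute_coords c f)) L'"
    unfolding class_parallel_def
    using over1 LD'(1) over first second par unfolding reindex_def by blast
  then show ?thesis using f by blast
qed

end

theorem theorem9p6:
  fixes X :: "(int \<Rightarrow> 'a::alphabet) set"
    and Y :: "(int \<Rightarrow> 'b::alphabet) set"
    and \<pi> :: "(int \<Rightarrow> 'a) \<Rightarrow> (int \<Rightarrow> 'b)"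
    and \<nu> :: "(int \<Rightarrow> 'b) measure"
    and L L' :: "(nat \<Rightarrow> int \<Rightarrow> 'a) measure"
    and c :: nat
  assumes "sft X"
    and "shift_space Y"
    and "factor_code X Y \<pi>"
    and "ergodic_measure_on Y \<nu>"
    and "c = class_degree X \<pi> \<nu>"
    and "class_degree_joining X Y \<pi> \<nu> L"
    and "class_degree_joining X Y \<pi> \<nu> L'"
  shows "\<exists>f. f permutes {1..c} \<and>
    class_parallel X Y \<pi> \<nu> c (distr L (borel_pow X c) (permute_coords c f)) L'"
proof -
  obtain R where "local_code X \<pi> R" using factor_code_local_code[OF assms(1,3)] .
  then interpret local_code X \<pi> R .
  have "Y = \<pi> ` X" using assms(3) by (simp add: factor_code_def)
  then show ?thesis using class_degree_joinings_parallel assms(4-7) by simp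
qed

end
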